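(* Let $h_d$ be a $d$-quadratic sensing metric, and consider an ISAC system with $K$ communication users. Let $$\tilde{\mathcal{A}}^{\mathrm{IC}}=\{(h_d(\mathbf{V}),\mathrm{vSINR}^{\mathrm{IC}}_{\mathbf{V}}):\mathbf{V}\in\mathbb{C}^{N_T\times(N_T+K)},\ \mathrm{tr}(\mathbf{V}\mathbf{V}^{H})\le P\},$$ $$\tilde{\mathcal{A}}^{\mathrm{NIC}}=\{(h_d(\mathbf{V}),\mathrm{vSINR}^{\mathrm{NIC}}_{\mathbf{V}}):\mathbf{V}\in\mathbb{C}^{N_T\times(N_T+K)},\ \mathrm{tr}(\mathbf{V}\mathbf{V}^{H})\le P\}.$$ Then: 1. For every $(h,\boldsymbol{\gamma})\in\tilde{\mathcal{A}}^{\mathrm{IC}}$ with $\boldsymbol{\gamma}>\mathbf{0}$ (entrywise), there exist an integer $N'$ with $K\le N'\le\lfloor K+\sqrt{d}\rfloor$ and $\mathbf{V}'\in\mathbb{C}^{N_T\times N'}$ with $\mathrm{tr}(\mathbf{V}'\mathbf{V}'^{H})\le P$, $h_d(\mathbf{V}')=h$ and $\mathrm{vSINR}^{\mathrm{IC}}_{\mathbf{V}'}\ge\boldsymbol{\gamma}$ (entrywise). 2. For every $(h,\boldsymbol{\gamma})\in\tilde{\mathcal{A}}^{\mathrm{NIC}}$ with $\boldsymbol{\gamma}>\mathbf{0}$ (entrywise), there exist an integer $N'$ with $K\le N'\le\lfloor\sqrt{K^2+d}\rfloor$ and $\mathbf{V}'\in\mathbb{C}^{N_T\times N'}$ with $\mathrm{tr}(\mathbf{V}'\mathbf{V}'^{H})\le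 P$, $h_d(\mathbf{V}')=h$ and $\mathrm{vSINR}^{\mathrm{NIC}}_{\mathbf{V}'}\ge\boldsymbol{\gamma}$ (entrywise).
   Context: Integers $N_T,d\ge1$, $K\ge0$; reals $\sigma^2>0$, $P>0$; fixed channel vectors $\mathbf{h}_1,\dots,\mathbf{h}_K\in\mathbb{C}^{N_T}$. Beamformers: for $N\ge K$, a beamforming matrix with $N$ beamformers is $\mathbf{V}=[\mathbf{v}_1,\dots,\mathbf{v}_K,\mathbf{V}_s]\in\mathbb{C}^{N_T\times N}$, with communication beamformers $\mathbf{v}_k\in\mathbb{C}^{N_T}$ and sensing beamformers $\mathbf{V}_s\in\mathbb{C}^{N_T\times(N-K)}$. $d$-quadratic: a real function $h_d$ of beamforming matrices $\mathbf{V}\in\mathbb{C}^{N_T\times N}$ (defined by the same formula for every $N$) is $d$-quadratic if $h_d(\mathbf{V})=f(\mathrm{tr}(\mathbf{Q}_1\mathbf{V}\mathbf{V}^{H}),\dots,\mathrm{tr}(\mathbf{Q}_d\mathbf{V}\mathbf{V}^{H}))$ for some linearly independent Hermitian matrices $\mathbf{Q}_1,\dots,\mathbf{Q}_d\in\mathbb{C}^{N_T\times N_T}$ and some function $f:\mathbb{R}^d\to\mathbb{R}$. SINRs with (IC) and without (NIC) cancellation of interference from the sensing beams: $\mathrm{SINR}^{\mathrm{IC}}_{k,\mathbf{V}}=\dfrac{|\mathbf{h}_k^{H}\mathbf{v}_k|^2}{\sum_{i\ne k}|\mathbf{h}_k^{H}\mathbf{v}_i|^2+\sigma^2}$, $\quad\mathrm{SINR}^{\mathrm{NIC}}_{k,\mathbf{V}}=\dfrac{|\mathbf{h}_k^{H}\mathbf{v}_k|^2}{\sum_{i\ne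 k}|\mathbf{h}_k^{H}\mathbf{v}_i|^2+\mathbf{h}_k^{H}\mathbf{V}_s\mathbf{V}_s^{H}\mathbf{h}_k+\sigma^2}$; $\mathrm{vSINR}^{\mathrm{IC}}_{\mathbf{V}}$ and $\mathrm{vSINR}^{\mathrm{NIC}}_{\mathbf{V}}$ are the corresponding vectors in $\mathbb{R}^K$ over $k=1,\dots,K$. *)

theory Defs
  imports "Jordan_Normal_Form.Schur_Decomposition"
begin

definition mat_trace :: "'a :: comm_monoid_add mat \<Rightarrow> 'a" where
  "mat_trace A = (\<Sum>i<dim_row A. A $$ (i, i))"

definition hermitian_mat :: "complex mat \<Rightarrow> bool" where
  "hermitian_mat A \<longleftrightarrow> mat_adjoint A = A"

(* The n x n Hermitian matrices form a real vector space, so the scalars are real; for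
   Hermitian families this agrees with independence over the complex numbers. *)
definition lin_indep_mats :: "nat \<Rightarrow> nat \<Rightarrow> (nat \<Rightarrow> complex mat) \<Rightarrow> bool" where
  "lin_indep_mats n d Q \<longleftrightarrow>
     (\<forall>c :: nat \<Rightarrow> real.
        (\<forall>a<n. \<forall>b<n. (\<Sum>i<d. complex_of_real (c i) * Q i $$ (a, b)) = 0) \<longrightarrow>
        (\<forall>i<d. c i = 0))"

(* V has columns v_1, ..., v_K (indices 0, ..., K-1) followed by those of V_s. *)
definition beamforming_mats :: "nat \<Rightarrow> nat \<Rightarrow> complex mat set" where
  "beamforming_mats NT K = {V. \<exists>N\<ge>K. V \<in> carrier_mat NT N}"

definition comm_beam :: "complex mat \<Rightarrow> nat \<Rightarrow> complex vec" where
  "comm_beam V k = col V k"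

definition sensing_beams :: "nat \<Rightarrow> complex mat \<Rightarrow> complex mat" where
  "sensing_beams K V = mat (dim_row V) (dim_col V - K) (\<lambda>(i, j). V $$ (i, K + j))"

(* tr(Q V V^H) is real for Hermitian Q, so Re discards nothing where these are used. *)
definition quad_trace :: "complex mat \<Rightarrow> complex mat \<Rightarrow> real" where
  "quad_trace Q V = Re (mat_trace (Q * V * mat_adjoint V))"

definition tx_power :: "complex mat \<Rightarrow> real" where
  "tx_power V = Re (mat_trace (V * mat_adjoint V))"

(* Q and f are chosen before V: one formula serves every number of columns. *)
definition d_quadratic :: "nat \<Rightarrow> nat \<Rightarrow> nat \<Rightarrow> (complex mat \<Rightarrow> real) \<Rightarrow> bool" where
  "d_quadratic NT K d h \<longleftrightarrow>
     (\<exists>(Q :: nat \<Rightarrow> complex mat) (f :: real vec \<Rightarrow> real).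
        (\<forall>i<d. Q i \<in> carrier_mat NT NT \<and> hermitian_mat (Q i)) \<and>
        lin_indep_mats NT d Q \<and>
        (\<forall>V\<in>beamforming_mats NT K. h V = f (vec d (\<lambda>i. quad_trace (Q i) V))))"

(* x \<bullet>c y conjugates its second argument, so v \<bullet>c h is h^H v. *)
definition beam_gain :: "complex vec \<Rightarrow> complex vec \<Rightarrow> real" where
  "beam_gain h v = (cmod (v \<bullet>c h))\<^sup>2"

definition SINR_IC :: "nat \<Rightarrow> (nat \<Rightarrow> complex vec) \<Rightarrow> real \<Rightarrow> complex mat \<Rightarrow> nat \<Rightarrow> real" where
  "SINR_IC K H \<sigma>2 V k =
     beam_gain (H k) (comm_beam V k) /
     ((\<Sum>i\<in>{..<K} - {k}. beam_gain (H k) (comm_beam V i)) + \<sigma>2)"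

definition sensing_interference :: "nat \<Rightarrow> complex vec \<Rightarrow> complex mat \<Rightarrow> real" where
  "sensing_interference K h V =
     Re (((sensing_beams K V * mat_adjoint (sensing_beams K V)) *\<^sub>v h) \<bullet>c h)"

definition SINR_NIC :: "nat \<Rightarrow> (nat \<Rightarrow> complex vec) \<Rightarrow> real \<Rightarrow> complex mat \<Rightarrow> nat \<Rightarrow> real" where
  "SINR_NIC K H \<sigma>2 V k =
     beam_gain (H k) (comm_beam V k) /
     ((\<Sum>i\<in>{..<K} - {k}. beam_gain (H k) (comm_beam V i))
        + sensing_interference K (H k) V + \<sigma>2)"

definition vSINR_IC :: "nat \<Rightarrow> (nat \<Rightarrow> complex vec) \<Rightarrow> real \<Rightarrow> complex mat \<Rightarrow> real vec" where
  "vSINR_IC K H \<sigma>2 V = vec K (SINR_IC K H \<sigma>2 V)"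

definition vSINR_NIC :: "nat \<Rightarrow> (nat \<Rightarrow> complex vec) \<Rightarrow> real \<Rightarrow> complex mat \<Rightarrow> real vec" where
  "vSINR_NIC K H \<sigma>2 V = vec K (SINR_NIC K H \<sigma>2 V)"

definition achievable_set ::
  "nat \<Rightarrow> nat \<Rightarrow> real \<Rightarrow> (complex mat \<Rightarrow> real) \<Rightarrow> (complex mat \<Rightarrow> real vec) \<Rightarrow> (real \<times> real vec) set"
where
  "achievable_set NT K P h vSINR =
     {(h V, vSINR V) | V. V \<in> carrier_mat NT (NT + K) \<and> tx_power V \<le> P}"

end

theory Submission
  imports "HOL-Analysis.Function_Topology" "HOL-Analysis.Topology_Euclidean_Space" Defs
begin

text \<open>The sensing metric and the power depend on \<open>V\<close> only through \<open>V V\<^sup>H\<close>. Replacing \<open>V\<close> by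
  \<open>V Z\<close> with \<open>Z Z\<^sup>H = I + t D\<close>, where the Hermitian matrix \<open>D\<close> is orthogonal to the \<open>d\<close> matrices
  \<open>V\<^sup>H Q\<^sub>i V\<close> and \<open>t\<close> makes \<open>I + t D\<close> singular, removes a column. For interference cancellation
  this is applied to the sensing beams alone, as long as their number exceeds \<open>sqrt d\<close>. Without
  cancellation, the sensing beams are first made orthogonal to all user channels by a unitary
  change of columns that does not decrease any \<open>|h\<^sub>k\<^sup>H v\<^sub>k|\<close>; then \<open>D\<close> may have any entries
  outside the leading \<open>K \<times> K\<close> block, so that such a \<open>D\<close> exists as long as \<open>N\<^sup>2 - K\<^sup>2 > d\<close>, and
  the gains of the communication beams are unchanged.\<close>

section \<open>Nulling the sensing beams\<close>

text \<open>The matrix \<open>V V^H\<close> for \<open>N\<close> columns. Matrices are plain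
  functions with sizes passed separately, so columns can be merged or dropped without changing a
  carrier.\<close>

definition gram :: "nat \<Rightarrow> (nat \<Rightarrow> nat \<Rightarrow> complex) \<Rightarrow> nat \<Rightarrow> nat \<Rightarrow> complex" where
  "gram N V a b = (\<Sum>j<N. V a j * cnj (V b j))"

text \<open>The inner product \<open>h^H v_j\<close>: the amplitude with which a user with channel
  \<open>h\<close> receives column \<open>j\<close>.\<close>

definition response :: "nat \<Rightarrow> (nat \<Rightarrow> complex) \<Rightarrow> (nat \<Rightarrow> nat \<Rightarrow> complex) \<Rightarrow> nat \<Rightarrow> complex" where
  "response n h V j = (\<Sum>a<n. V a j * cnj (h a))"

text \<open>Tychonoff: the set is a product of closed discs and of copies of the singleton of 0.
  Fixing the value 0 off \<open>S\<close> keeps those factors compact, so extreme value arguments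
  apply directly to functions.\<close>

lemma compact_bounded_functions:
  fixes S :: "'i set"
  shows "compact {f :: 'i \<Rightarrow> complex. (\<forall>p\<in>S. cmod (f p) \<le> B) \<and> (\<forall>p. p \<notin> S \<longrightarrow> f p = 0)}"
    (is "compact ?C")
proof -
  let ?X = "\<lambda>p. if p \<in> S then cball 0 B else {0 :: complex}"
  have "compactin (product_topology (\<lambda>_. euclidean) UNIV) (PiE UNIV ?X)"
    unfolding compactin_PiE by (auto simp: compactin_euclidean_iff)
  moreover have "PiE UNIV ?X = ?C"
    by (force simp: PiE_iff split: if_splits)
  ultimately show ?thesis
    by (simp add: euclidean_product_topology compactin_euclidean_iff)
qed

lemma sum_split_two:
  assumes "finite A" "k \<in> A" "j \<in> A" "k \<noteq> j"
  shows "sum f A = sum f (A - {k, j}) + (f k + f j :: 'a :: comm_monoid_add)"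
proof -
  have "sum f A = sum f (A - {k, j}) + sum f {k, j}"
    using assms by (intro sum.subset_diff) auto
  then show ?thesis using assms by simp
qed

text \<open>A diagonal entry is the squared norm of a row. Prescribing the covariance therefore
  bounds all entries, which is what compactness requires.\<close>

lemma cmod_entry_le_gram:
  assumes "j < N"
  shows "(cmod (V a j))\<^sup>2 \<le> Re (gram N V a a)"
proof -
  have "Re (gram N V a a) = (\<Sum>j<N. (cmod (V a j))\<^sup>2)"
    unfolding gram_def Re_sum by (intro sum.cong refl) (simp add: cmod_def power2_eq_square)
  then show ?thesis
    using assms by (auto intro: member_le_sum)
qed

lemma rotation_unit:
  fixes \<alpha> \<beta> :: complex and r :: real
  assumes "r\<^sup>2 = (cmod \<alpha>)\<^sup>2 + (cmod \<beta>)\<^sup>2"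
  shows "\<alpha> * cnj \<alpha> + \<beta> * cnj \<beta> = complex_of_real r * complex_of_real r"
proof -
  have "complex_of_real r * complex_of_real r = complex_of_real (r\<^sup>2)"
    by (simp add: power2_eq_square)
  also have "\<dots> = \<alpha> * cnj \<alpha> + \<beta> * cnj \<beta>"
    unfolding assms by (simp only: of_real_add complex_norm_square)
  finally show ?thesis by simp
qed

text \<open>Among all beamformers with the same covariance and undiminished useful gains, one
  maximising the sum of the gains nulls the sensing beams at every user: rotating the columns
  \<open>k\<close> and \<open>j \<ge> K\<close> into each other moves the whole response of beam \<open>j\<close> at user \<open>k\<close> into
  beam \<open>k\<close> and changes no other useful gain.\<close>

lemma exists_nulling_beamformers:
  fixes V h :: "nat \<Rightarrow> nat \<Rightarrow> complex"
  assumes KN: "K \<le> N"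
  obtains W where
    "\<And>a b. a < n \<Longrightarrow> b < n \<Longrightarrow> gram N W a b = gram N V a b"
    "\<And>k. k < K \<Longrightarrow> cmod (response n (h k) V k) \<le> cmod (response n (h k) W k)"
    "\<And>k j. k < K \<Longrightarrow> K \<le> j \<Longrightarrow> j < N \<Longrightarrow> response n (h k) W j = 0"
proof -
  \<comment> \<open>The summand 1 gives \<open>B \<le> B\<^sup>2\<close>, which turns a bound on
    squared moduli into one on moduli.\<close>
  define B where "B = 1 + (\<Sum>a<n. Re (gram N V a a))"
  define S where "S = {..<n} \<times> {..<N}"
  \<comment> \<open>Candidates are indexed by pairs to fit \<open>compact_bounded_functions\<close>;
    \<open>M\<close> curries them.\<close>
  define M :: "(nat \<times> nat \<Rightarrow> complex) \<Rightarrow> nat \<Rightarrow> nat \<Rightarrow> complex" where "M f a j = f (a, j)" for f a j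
  define box where "box = {f. (\<forall>p\<in>S. cmod (f p) \<le> B) \<and> (\<forall>p. p \<notin> S \<longrightarrow> f p = 0)}"
  define good where "good = (\<lambda>f. (\<forall>a\<in>{..<n}. \<forall>b\<in>{..<n}. gram N (M f) a b = gram N V a b) \<and>
     (\<forall>k\<in>{..<K}. cmod (response n (h k) V k) \<le> cmod (response n (h k) (M f) k)))"
  define F where "F = (\<lambda>f. \<Sum>k<K. cmod (response n (h k) (M f) k))"
  have cont: "continuous_on UNIV (\<lambda>f :: nat \<times> nat \<Rightarrow> complex. f p)" for p
    by simp
  \<comment> \<open>Every constraint is an equation or a weak inequality between continuous
    functions of finitely many entries.\<close>
  have clo: "closed (Collect good)"
    unfolding good_def gram_def response_def M_def Ball_def
    by (intro closed_Collect_conj closed_Collect_all closed_Collect_imp open_Collect_const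
        closed_Collect_eq closed_Collect_le continuous_intros cont)
  have cpt: "compact (box \<inter> Collect good)"
    using compact_bounded_functions[of S B] clo unfolding box_def by (rule compact_Int_closed)
  have in_box: "f \<in> box" if "good f" "\<And>p. p \<notin> S \<Longrightarrow> f p = 0" for f
  proof -
    have "cmod (f p) \<le> B" if "p \<in> S" for p
    proof -
      obtain a j where p: "p = (a, j)" "a < n" "j < N" using \<open>p \<in> S\<close> by (auto simp: S_def)
      have nn: "0 \<le> Re (gram N V a a)" for a
        unfolding gram_def Re_sum by (rule sum_nonneg) simp
      have B: "1 \<le> B" "(\<Sum>a<n. Re (gram N V a a)) \<le> B"
        using sum_nonneg[of "{..<n}" "\<lambda>a. Re (gram N V a a)", OF nn] unfolding B_def by linarith+
      have "(cmod (f p))\<^sup>2 \<le> Re (gram N (M f) a a)"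
        using cmod_entry_le_gram[of j N "M f" a] p by (simp add: M_def)
      also have "\<dots> = Re (gram N V a a)"
        using \<open>good f\<close> p(2) unfolding good_def by simp
      also have "\<dots> \<le> (\<Sum>a<n. Re (gram N V a a))"
        using p(2) nn by (intro member_le_sum) simp_all
      also note B(2)
      also have "B \<le> B\<^sup>2"
        using B(1) mult_left_mono[of 1 B B] by (simp add: power2_eq_square)
      finally show ?thesis
        by (rule power2_le_imp_le) (use B(1) in simp)
    qed
    then show ?thesis using that(2) unfolding box_def by blast
  qed
  have ne: "box \<inter> Collect good \<noteq> {}"
  proof -
    \<comment> \<open>The original beamformers, set to zero outside the index range, are
      feasible.\<close>
    define f where "f = (\<lambda>(a, j). if (a, j) \<in> S then V a j else 0)"
    have "good f"
      using KN by (auto simp: good_def gram_def response_def M_def f_def S_def intro!: sum.cong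
          intro: eq_refl arg_cong[of _ _ cmod])
    moreover from this have "f \<in> box"
      by (rule in_box) (auto simp: f_def)
    ultimately show ?thesis by blast
  qed
  have F: "continuous_on (box \<inter> Collect good) F"
    unfolding F_def response_def M_def
    by (intro continuous_intros continuous_on_subset[OF cont]) auto
  obtain f where f: "f \<in> box" "good f"
    and max: "\<And>g. g \<in> box \<Longrightarrow> good g \<Longrightarrow> F g \<le> F f"
    using continuous_attains_sup[OF cpt ne F] by auto
  have "response n (h k) (M f) j = 0" if kj: "k < K" "K \<le> j" "j < N" for k j
  proof (rule ccontr)
    define \<alpha> where "\<alpha> = response n (h k) (M f) k"
    define \<beta> where "\<beta> = response n (h k) (M f) j"
    define r where "r = sqrt ((cmod \<alpha>)\<^sup>2 + (cmod \<beta>)\<^sup>2)"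
    assume "response n (h k) (M f) j \<noteq> 0"
    then have \<beta>: "\<beta> \<noteq> 0" by (simp add: \<beta>_def)
    have r: "cmod \<alpha> < r"
      unfolding r_def by (rule real_less_rsqrt) (simp add: \<beta>)
    then have r0: "r > 0" using norm_ge_zero[of \<alpha>] by linarith
    have rr: "\<alpha> * cnj \<alpha> + \<beta> * cnj \<beta> = of_real r * of_real r"
      by (rule rotation_unit) (simp add: r_def)
    \<comment> \<open>A unitary rotation of columns \<open>k\<close> and \<open>j\<close>: at user
      \<open>k\<close> the new column \<open>k\<close> has response
      \<open>(|\<alpha>|^2 + |\<beta>|^2) / r = r\<close>, and the new column \<open>j\<close> has
      response 0.\<close>
    define g where "g = (\<lambda>(a, l).
      if a < n then
        if l = k then (cnj \<alpha> * M f a k + cnj \<beta> * M f a j) / of_real r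
        else if l = j then (\<alpha> * M f a j - \<beta> * M f a k) / of_real r
        else M f a l
      else 0)"
    have kN: "k \<in> {..<N}" "j \<in> {..<N}" "k \<noteq> j" using kj KN by auto
    have "gram N (M g) a b = gram N (M f) a b" if ab: "a < n" "b < n" for a b
    proof -
      have two: "(cnj \<alpha> * x + cnj \<beta> * y) / of_real r * cnj ((cnj \<alpha> * x' + cnj \<beta> * y') / of_real r)
          + (\<alpha> * y - \<beta> * x) / of_real r * cnj ((\<alpha> * y' - \<beta> * x') / of_real r)
          = x * cnj x' + y * cnj y'" (is "?L = ?R") for x y x' y'
      proof -
        have "?L = ((cnj \<alpha> * x + cnj \<beta> * y) * (\<alpha> * cnj x' + \<beta> * cnj y')
            + (\<alpha> * y - \<beta> * x) * (cnj \<alpha> * cnj y' - cnj \<beta> * cnj x')) / (of_real r * of_real r)"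
          by (simp only: complex_cnj_divide complex_cnj_add complex_cnj_diff complex_cnj_mult
              complex_cnj_cnj complex_cnj_complex_of_real times_divide_times_eq
              add_divide_distrib[symmetric])
        also have "(cnj \<alpha> * x + cnj \<beta> * y) * (\<alpha> * cnj x' + \<beta> * cnj y')
            + (\<alpha> * y - \<beta> * x) * (cnj \<alpha> * cnj y' - cnj \<beta> * cnj x')
          = (\<alpha> * cnj \<alpha> + \<beta> * cnj \<beta>) * ?R"
          by (simp add: algebra_simps)
        also have "\<dots> / (of_real r * of_real r) = ?R" using r0 unfolding rr by simp
        finally show ?thesis .
      qed
      have "(\<Sum>l\<in>{..<N} - {k, j}. M g a l * cnj (M g b l))
          = (\<Sum>l\<in>{..<N} - {k, j}. M f a l * cnj (M f b l))"
        using ab by (intro sum.cong) (auto simp: g_def M_def)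
      moreover have "M g a k * cnj (M g b k) + M g a j * cnj (M g b j)
          = M f a k * cnj (M f b k) + M f a j * cnj (M f b j)"
        using ab kN two by (simp add: g_def M_def)
      ultimately show ?thesis
        unfolding gram_def sum_split_two[OF finite_lessThan kN] by simp
    qed
    \<comment> \<open>Since \<open>i \<noteq> k\<close> and \<open>i < K \<le> j\<close>, column
      \<open>i\<close> is not one of the two rotated columns.\<close>
    moreover have resp_other: "response n (h i) (M g) i = response n (h i) (M f) i"
      if "i < K" "i \<noteq> k" for i
      using that kj by (auto simp: response_def g_def M_def intro!: sum.cong)
    moreover have resp_k: "response n (h k) (M g) k = of_real r"
    proof -
      have "response n (h k) (M g) k = (\<Sum>a<n. cnj \<alpha> / of_real r * (M f a k * cnj (h k a))
          + cnj \<beta> / of_real r * (M f a j * cnj (h k a)))"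
        unfolding response_def
        by (intro sum.cong) (simp_all add: g_def M_def add_divide_distrib distrib_right mult.assoc)
      also have "\<dots> = cnj \<alpha> / of_real r * \<alpha> + cnj \<beta> / of_real r * \<beta>"
        unfolding sum.distrib sum_distrib_left[symmetric] response_def[symmetric]
          \<alpha>_def[symmetric] \<beta>_def[symmetric] ..
      also have "\<dots> = (\<alpha> * cnj \<alpha> + \<beta> * cnj \<beta>) / of_real r"
        by (simp add: add_divide_distrib mult.commute)
      finally show ?thesis using r0 unfolding rr by simp
    qed
    moreover have gain: "cmod (response n (h i) (M f) i) \<le> cmod (response n (h i) (M g) i)" if "i < K" for i
      using that resp_other[of i] resp_k r r0 by (cases "i = k") (auto simp: \<alpha>_def)
    ultimately have "good g"
      using f(2) unfolding good_def by (auto intro: order_trans[OF _ gain])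
    moreover have "g p = 0" if "p \<notin> S" for p
      using that f(1) kN by (cases p) (auto simp: g_def S_def M_def box_def)
    ultimately have "F g \<le> F f" by (intro max in_box)
    moreover have "F f < F g"
      unfolding F_def
    proof (rule sum_strict_mono_ex1)
      show "\<forall>i\<in>{..<K}. cmod (response n (h i) (M f) i) \<le> cmod (response n (h i) (M g) i)"
        using gain by simp
      show "\<exists>i\<in>{..<K}. cmod (response n (h i) (M f) i) < cmod (response n (h i) (M g) i)"
        using resp_k r r0 kj by (intro bexI[of _ k]) (auto simp: \<alpha>_def)
    qed simp
    ultimately show False by simp
  qed
  then show thesis
    using f(2) by (intro that[of "M f"]) (auto simp: good_def)
qed

section \<open>Gram factors of singular positive semidefinite matrices\<close>

text \<open>The value \<open>z^H D z\<close>; it is already real when \<open>D\<close> is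
  Hermitian.\<close>

definition quad_form :: "nat \<Rightarrow> (nat \<Rightarrow> nat \<Rightarrow> complex) \<Rightarrow> (nat \<Rightarrow> complex) \<Rightarrow> real" where
  "quad_form N D z = Re (\<Sum>i<N. \<Sum>j<N. cnj (z i) * D i j * z j)"

definition hermitian_on :: "nat \<Rightarrow> (nat \<Rightarrow> nat \<Rightarrow> complex) \<Rightarrow> bool" where
  "hermitian_on m X \<longleftrightarrow> (\<forall>i<m. \<forall>j<m. X j i = cnj (X i j))"

lemma hermitian_onD: "hermitian_on m X \<Longrightarrow> i < m \<Longrightarrow> j < m \<Longrightarrow> cnj (X i j) = X j i"
  unfolding hermitian_on_def by metis

lemma Re_cnj_mult_self: "Re (cnj u * u) = (cmod u)\<^sup>2"
  unfolding cmod_power2 by (simp add: power2_eq_square)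

lemma cmod_add_square: "(cmod (x + y))\<^sup>2 = (cmod x)\<^sup>2 + 2 * Re (cnj x * y) + (cmod y)\<^sup>2"
  unfolding cmod_power2 by (simp add: power2_eq_square algebra_simps)

text \<open>By Hermitian symmetry the last row and the last column contribute conjugate cross terms,
  which add up to twice a real part.\<close>

lemma quad_form_Suc:
  assumes "hermitian_on (Suc m) X"
  shows "quad_form (Suc m) X z = quad_form m X z
    + 2 * Re (cnj (z m) * (\<Sum>j<m. X m j * z j)) + Re (X m m) * (cmod (z m))\<^sup>2"
proof -
  have "(\<Sum>i<m. cnj (z i) * X i m * z m) = cnj (cnj (z m) * (\<Sum>j<m. X m j * z j))"
    unfolding complex_cnj_mult cnj_sum sum_distrib_left complex_cnj_cnj
    by (intro sum.cong refl) (simp add: hermitian_onD[OF assms])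
  then have "Re (\<Sum>i<m. cnj (z i) * X i m * z m) = Re (cnj (z m) * (\<Sum>j<m. X m j * z j))"
    by (simp only: cnj.sel)
  moreover have "Re (cnj (z m) * X m m * z m) = Re (X m m) * (cmod (z m))\<^sup>2"
  proof -
    have "Im (X m m) = 0"
      using hermitian_onD[OF assms, of m m] by (simp add: complex_eq_iff)
    then show ?thesis unfolding cmod_power2 by (simp add: power2_eq_square algebra_simps)
  qed
  moreover have "(\<Sum>j<m. cnj (z m) * X m j * z j) = cnj (z m) * (\<Sum>j<m. X m j * z j)"
    by (simp add: sum_distrib_left mult.assoc)
  ultimately show ?thesis
    by (simp add: quad_form_def sum.distrib del: times_complex.sel)
qed

lemma quad_form_cong:
  assumes "\<And>i j. i < m \<Longrightarrow> j < m \<Longrightarrow> X i j = X' i j" "\<And>i. i < m \<Longrightarrow> z i = z' i"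
  shows "quad_form m X z = quad_form m X' z'"
  unfolding quad_form_def
  by (intro arg_cong[where f = Re] sum.cong refl) (simp add: assms)

text \<open>Column \<open>m\<close> is the conjugate of row \<open>m\<close>, so the form of the
  subtracted rank-one matrix is a squared modulus divided by \<open>a\<close>. For \<open>a\<close>
  the last pivot this is the Schur complement.\<close>

lemma quad_form_minus_rank_one:
  assumes herm: "hermitian_on (Suc m) X"
  shows "quad_form m (\<lambda>i j. X i j - X i m * X m j / complex_of_real a) z
    = quad_form m X z - (cmod (\<Sum>j<m. X m j * z j))\<^sup>2 / a"
proof -
  define u where "u = (\<Sum>j<m. X m j * z j)"
  have u: "(\<Sum>i<m. cnj (z i) * X i m) = cnj u"
    unfolding u_def cnj_sum by (intro sum.cong refl) (simp add: hermitian_onD[OF herm])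
  have "(\<Sum>i<m. \<Sum>j<m. cnj (z i) * (X i m * X m j / of_real a) * z j)
      = (\<Sum>i<m. cnj (z i) * X i m) * u / of_real a"
    by (simp add: u_def sum_product sum_divide_distrib mult.assoc)
  also have "\<dots> = of_real ((cmod u)\<^sup>2 / a)"
    unfolding u of_real_divide complex_norm_square by (simp only: mult.commute)
  finally have "Re (\<Sum>i<m. \<Sum>j<m. cnj (z i) * (X i m * X m j / of_real a) * z j) = (cmod u)\<^sup>2 / a"
    by simp
  then show ?thesis
    unfolding quad_form_def right_diff_distrib left_diff_distrib sum_subtractf minus_complex.sel
      u_def[symmetric] by (simp only:)
qed

text \<open>The last row and column are eliminated first; an isotropic vector of \<open>X\<close> restricts to
  one of the Schur complement, so that it costs one factor along the way.\<close>

lemma psd_gram_factor: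
  assumes "hermitian_on m X" "\<And>z. 0 \<le> quad_form m X z"
  shows "\<exists>Y r. r \<le> m \<and> (\<forall>i<m. \<forall>j<m. gram r Y i j = X i j) \<and>
    ((\<exists>z. quad_form m X z = 0 \<and> (\<exists>i<m. z i \<noteq> 0)) \<longrightarrow> r < m)"
  using assms
proof (induction m arbitrary: X)
  case 0
  then show ?case by simp
next
  case (Suc m)
  note herm = Suc.prems(1) and psd = Suc.prems(2)
  define a where "a = Re (X m m)"
  have Xmm: "X m m = of_real a"
    using hermitian_onD[OF herm, of m m] by (simp add: complex_eq_iff a_def)
  define u where "u z = (\<Sum>j<m. X m j * z j)" for z
  have form: "quad_form (Suc m) X z = quad_form m X z + 2 * Re (cnj (z m) * u z) + a * (cmod (z m))\<^sup>2" for z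
    using quad_form_Suc[OF herm] by (simp add: u_def a_def)
  have u_upd: "u (z(m := w)) = u z" for z w
    by (simp add: u_def)
  have form_upd: "quad_form m X' (z(m := w)) = quad_form m X' z" for z w X'
    by (rule quad_form_cong) auto
  have a0: "0 \<le> a"
    using psd[of "\<lambda>i. if i = m then 1 else 0"] unfolding form by (simp add: u_def quad_form_def)
  have herm': "hermitian_on m X"
    using hermitian_onD[OF herm] by (simp add: hermitian_on_def)
  show ?case
  proof (cases "a = 0")
    case True
    have u0: "u z = 0" for z
    proof (rule ccontr)
      assume nz: "u z \<noteq> 0"
      \<comment> \<open>With a zero pivot the form is affine in the last coordinate; this
        \<open>t\<close> brings its value down to -1.\<close>
      define t where "t = (quad_form m X z + 1) / (2 * (cmod (u z))\<^sup>2)"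
      have "0 \<le> quad_form (Suc m) X (z(m := - of_real t * u z))" by (rule psd)
      also have "\<dots> = quad_form m X z - 2 * t * (cmod (u z))\<^sup>2"
      proof -
        have "Re (cnj (- of_real t * u z) * u z) = - t * Re (cnj (u z) * u z)"
          by (simp add: algebra_simps)
        then show ?thesis
          unfolding form u_upd form_upd Re_cnj_mult_self by (simp add: True)
      qed
      also have "\<dots> = - 1" using nz by (simp add: t_def field_simps)
      finally show False by simp
    qed
    have row0: "X m i = 0" if "i < m" for i
    proof -
      have "u (\<lambda>j. if j = i then 1 else 0) = (\<Sum>j<m. if j = i then X m j else 0)"
        unfolding u_def by (intro sum.cong) auto
      then show ?thesis using that u0 by simp
    qed
    then have col0: "X i m = 0" if "i < m" for i
      using that hermitian_onD[OF herm, of m i] row0[of i] by simp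
    have psd': "0 \<le> quad_form m X z" for z
      using psd[of "z(m := 0)"] unfolding form form_upd by simp
    obtain Y r where Y: "r \<le> m" "\<forall>i<m. \<forall>j<m. gram r Y i j = X i j"
      using Suc.IH[OF herm' psd'] by blast
    \<comment> \<open>A vanishing last row needs no further column, so \<open>r \<le> m\<close> is
      already below \<open>Suc m\<close>.\<close>
    define Y' where "Y' i l = (if i < m then Y i l else 0)" for i l
    have "gram r Y' i j = X i j" if "i < Suc m" "j < Suc m" for i j
    proof (cases "i < m \<and> j < m")
      case ij: True
      then have "gram r Y' i j = gram r Y i j" by (simp add: gram_def Y'_def)
      then show ?thesis using Y(2) ij by simp
    next
      case False
      then have "X i j = 0"
        using that row0 col0 Xmm True by (auto simp: less_Suc_eq)
      then show ?thesis using False by (auto simp: gram_def Y'_def)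
    qed
    then show ?thesis using Y(1) by (intro exI[of _ Y'] exI[of _ r]) auto
  next
    case False
    then have a: "a > 0" using a0 by simp
    define X' where "X' = (\<lambda>i j. X i j - X i m * X m j / complex_of_real a)"
    have form': "quad_form m X' z = quad_form m X z - (cmod (u z))\<^sup>2 / a" for z
      unfolding X'_def u_def by (rule quad_form_minus_rank_one[OF herm])
    \<comment> \<open>Completing the square in the last coordinate leaves the form of the Schur
      complement \<open>X'\<close>.\<close>
    have square: "quad_form (Suc m) X z = quad_form m X' z + a * (cmod (z m + u z / of_real a))\<^sup>2" for z
    proof -
      have "Re (cnj (z m) * (u z / of_real a)) = Re (cnj (z m) * u z) / a"
        by (simp only: times_divide_eq_right Re_divide_of_real)
      then show ?thesis
        unfolding form form' cmod_add_square using a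
        by (simp add: norm_divide power_divide power2_eq_square[of a] field_simps
            del: times_complex.sel)
    qed
    have "hermitian_on m X'"
      using hermitian_onD[OF herm] by (simp add: hermitian_on_def X'_def)
    \<comment> \<open>The last coordinate is chosen to make the square vanish.\<close>
    moreover have psd': "0 \<le> quad_form m X' z" for z
      using psd[of "z(m := - u z / of_real a)"] unfolding square form_upd u_upd by simp
    ultimately obtain Y r where Y: "r \<le> m" "\<forall>i<m. \<forall>j<m. gram r Y i j = X' i j"
      and sing: "(\<exists>z. quad_form m X' z = 0 \<and> (\<exists>i<m. z i \<noteq> 0)) \<longrightarrow> r < m"
      using Suc.IH[of X'] by blast
    \<comment> \<open>The pivot contributes one more column, as in a Cholesky factorisation.\<close>
    define Y' where "Y' i l = (if l < r then if i < m then Y i l else 0 else X i m / of_real (sqrt a))" for i l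
    have "gram (Suc r) Y' i j = X i j" if "i < Suc m" "j < Suc m" for i j
    proof -
      have ss: "complex_of_real (sqrt a) * complex_of_real (sqrt a) = of_real a"
        using a by (simp flip: of_real_mult)
      have "gram (Suc r) Y' i j = (if i < m \<and> j < m then gram r Y i j else 0) + X i m * cnj (X j m) / of_real a"
        using a by (auto simp: gram_def Y'_def ss)
      also have "cnj (X j m) = X m j"
        using hermitian_onD[OF herm, of j m] that by simp
      finally show ?thesis
        using that Y(2) a Xmm by (auto simp: X'_def less_Suc_eq)
    qed
    \<comment> \<open>Both nonnegative summands vanish at an isotropic vector. Its first
      \<open>m\<close> coordinates are not all zero, since otherwise the square would force
      \<open>z m = 0\<close> as well.\<close>
    moreover have "Suc r < Suc m" if "quad_form (Suc m) X z = 0" "\<exists>i<Suc m. z i \<noteq> 0" for z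
    proof -
      have "0 \<le> a * (cmod (z m + u z / of_real a))\<^sup>2" using a by simp
      then have "quad_form m X' z = 0" "a * (cmod (z m + u z / of_real a))\<^sup>2 = 0"
        using that(1) psd'[of z] unfolding square by linarith+
      moreover from this have zm: "z m = - u z / of_real a"
        using a by (simp add: eq_neg_iff_add_eq_0)
      moreover have "\<exists>i<m. z i \<noteq> 0"
      proof (rule ccontr)
        assume "\<not> ?thesis"
        then have "z m = 0" unfolding zm by (simp add: u_def)
        with that(2) \<open>\<not> ?thesis\<close> show False by (auto simp: less_Suc_eq)
      qed
      ultimately show ?thesis using sing by auto
    qed
    ultimately show ?thesis
      using Y(1) by (intro exI[of _ Y'] exI[of _ "Suc r"]) auto
  qed
qed

text \<open>Singularity leaves a factor with fewer than \<open>m\<close> columns, which is padded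
  with zero columns to exactly \<open>m - 1\<close>.\<close>

lemma singular_psd_gram_factor:
  assumes "hermitian_on m X" "\<And>z. 0 \<le> quad_form m X z"
    and "quad_form m X z = 0" "i < m" "z i \<noteq> 0"
  obtains Y where "\<And>i j. i < m \<Longrightarrow> j < m \<Longrightarrow> gram (m - 1) Y i j = X i j"
proof -
  obtain Y r where Y: "\<forall>i<m. \<forall>j<m. gram r Y i j = X i j" and "r < m"
    using psd_gram_factor[OF assms(1,2)] assms(3-) by blast
  define Y' where "Y' i l = (if l < r then Y i l else 0)" for i l
  have "gram (m - 1) Y' i j = gram r Y i j" for i j
    unfolding gram_def using \<open>r < m\<close>
    by (intro sum.mono_neutral_cong_right) (auto simp: Y'_def)
  then show ?thesis using Y by (intro that[of Y']) simp
qed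

section \<open>Factors that extend an identity block\<close>

lemma sum_lessThan_add:
  "(\<Sum>i<K + (m :: nat). f i) = (\<Sum>i<K. f i) + (\<Sum>l<m. f (K + l) :: 'a :: comm_monoid_add)"
  by (induction m) (simp_all add: add.assoc)

text \<open>The Schur complement of the identity block keeps the first \<open>K\<close> rows of the factor trivial.\<close>

lemma singular_psd_gram_factor_identity_block:
  assumes herm: "hermitian_on N X" and psd: "\<And>z. 0 \<le> quad_form N X z"
    and sing: "quad_form N X z = 0" "k < N" "z k \<noteq> 0"
    and K: "K \<le> N" and block: "\<And>i j. i < K \<Longrightarrow> j < K \<Longrightarrow> X i j = (if i = j then 1 else 0)"
  obtains Z where "\<And>i j. i < N \<Longrightarrow> j < N \<Longrightarrow> gram (N - 1) Z i j = X i j"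
    "\<And>i j. i < K \<Longrightarrow> Z i j = (if i = j then 1 else 0)" "K < N"
proof -
  define m where "m = N - K"
  have N: "N = K + m" using K by (simp add: m_def)
  note hermD = hermitian_onD[OF herm]
  define S where "S l l' = X (K + l) (K + l') - (\<Sum>i<K. X (K + l) i * X i (K + l'))" for l l'
  have hermS: "hermitian_on m S"
    unfolding hermitian_on_def S_def
    by (intro allI impI) (simp add: hermD N mult.commute)
  \<comment> \<open>Completing the squares in the first \<open>K\<close> coordinates at once;
    \<open>\<beta>\<close> is the off-diagonal block applied to the remaining coordinates.\<close>
  have square: "quad_form N X z = (\<Sum>i<K. (cmod (z i + (\<Sum>l<m. X i (K + l) * z (K + l))))\<^sup>2)
      + quad_form m S (\<lambda>l. z (K + l))" for z
  proof -
    define w where "w l = z (K + l)" for l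
    define \<beta> where "\<beta> i = (\<Sum>l<m. X i (K + l) * w l)" for i
    have cnj_\<beta>: "(\<Sum>l<m. cnj (w l) * X (K + l) i) = cnj (\<beta> i)" if "i < K" for i
      unfolding \<beta>_def cnj_sum using that
      by (intro sum.cong refl) (simp add: hermD N mult.commute)
    have top: "(\<Sum>i<K. \<Sum>j<K. cnj (z i) * X i j * z j) = (\<Sum>i<K. cnj (z i) * z i)"
    proof (intro sum.cong refl)
      fix i assume i: "i \<in> {..<K}"
      have "(\<Sum>j<K. cnj (z i) * X i j * z j) = (\<Sum>j<K. if j = i then cnj (z i) * z i else 0)"
        using i by (intro sum.cong refl) (auto simp: block)
      then show "(\<Sum>j<K. cnj (z i) * X i j * z j) = cnj (z i) * z i"
        using i by simp
    qed
    have right: "(\<Sum>i<K. \<Sum>l<m. cnj (z i) * X i (K + l) * z (K + l)) = (\<Sum>i<K. cnj (z i) * \<beta> i)"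
      by (simp add: \<beta>_def w_def sum_distrib_left mult.assoc)
    have left: "(\<Sum>l<m. \<Sum>j<K. cnj (z (K + l)) * X (K + l) j * z j) = (\<Sum>i<K. cnj (\<beta> i) * z i)"
      unfolding sum.swap[of _ "{..<K}"] w_def[symmetric] sum_distrib_right[symmetric]
      by (intro sum.cong refl) (simp add: cnj_\<beta>)
    have schur: "(\<Sum>l<m. \<Sum>l'<m. cnj (w l) * S l l' * w l')
        = (\<Sum>l<m. \<Sum>l'<m. cnj (w l) * X (K + l) (K + l') * w l') - (\<Sum>i<K. cnj (\<beta> i) * \<beta> i)"
    proof -
      have "(\<Sum>i<K. cnj (\<beta> i) * \<beta> i)
          = (\<Sum>i<K. (\<Sum>l<m. cnj (w l) * X (K + l) i) * (\<Sum>l'<m. X i (K + l') * w l'))"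
        by (intro sum.cong refl) (simp add: cnj_\<beta> flip: \<beta>_def)
      also have "\<dots> = (\<Sum>i<K. \<Sum>l<m. \<Sum>l'<m. cnj (w l) * (X (K + l) i * X i (K + l')) * w l')"
        by (simp add: sum_product mult.assoc)
      also have "\<dots> = (\<Sum>l<m. \<Sum>l'<m. \<Sum>i<K. cnj (w l) * (X (K + l) i * X i (K + l')) * w l')"
        by (rule trans[OF sum.swap]) (intro sum.cong refl sum.swap)
      also have "\<dots> = (\<Sum>l<m. \<Sum>l'<m. cnj (w l) * (\<Sum>i<K. X (K + l) i * X i (K + l')) * w l')"
        by (simp only: sum_distrib_left sum_distrib_right)
      finally show ?thesis
        unfolding S_def right_diff_distrib left_diff_distrib sum_subtractf by simp
    qed
    have "(\<Sum>i<N. \<Sum>j<N. cnj (z i) * X i j * z j)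
        = (\<Sum>i<K. cnj (z i) * z i) + (\<Sum>i<K. cnj (z i) * \<beta> i) + (\<Sum>i<K. cnj (\<beta> i) * z i)
          + (\<Sum>i<K. cnj (\<beta> i) * \<beta> i) + (\<Sum>l<m. \<Sum>l'<m. cnj (w l) * S l l' * w l')"
      unfolding N sum_lessThan_add sum.distrib top right left schur by (simp add: w_def)
    also have "(\<Sum>i<K. cnj (z i) * z i) + (\<Sum>i<K. cnj (z i) * \<beta> i) + (\<Sum>i<K. cnj (\<beta> i) * z i)
          + (\<Sum>i<K. cnj (\<beta> i) * \<beta> i) = (\<Sum>i<K. cnj (z i + \<beta> i) * (z i + \<beta> i))"
      unfolding sum.distrib[symmetric] by (intro sum.cong refl) (simp add: algebra_simps)
    finally show ?thesis
      unfolding quad_form_def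
      by (simp only: \<beta>_def w_def plus_complex.sel Re_sum Re_cnj_mult_self)
  qed
  have psdS: "0 \<le> quad_form m S w" for w
  proof -
    \<comment> \<open>The first \<open>K\<close> coordinates are chosen to make all the squares
      vanish.\<close>
    define z where "z i = (if i < K then - (\<Sum>l<m. X i (K + l) * w l) else w (i - K))" for i
    have "quad_form N X z = quad_form m S w"
      unfolding square by (simp add: z_def)
    then show ?thesis using psd[of z] by simp
  qed
  have top0: "(\<Sum>i<K. (cmod (z i + (\<Sum>l<m. X i (K + l) * z (K + l))))\<^sup>2) = 0"
    and singS: "quad_form m S (\<lambda>l. z (K + l)) = 0"
    using psdS[of "\<lambda>l. z (K + l)"] sing(1)
      sum_nonneg[of "{..<K}" "\<lambda>i. (cmod (z i + (\<Sum>l<m. X i (K + l) * z (K + l))))\<^sup>2"]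
    unfolding square by simp_all
  \<comment> \<open>If the trailing coordinates were zero, the vanishing squares would be those of
    the leading coordinates, and \<open>z\<close> would vanish entirely.\<close>
  have "\<exists>l<m. z (K + l) \<noteq> 0"
  proof (rule ccontr)
    assume no: "\<not> ?thesis"
    then have "k < K" using sing(2,3) N by (metis le_add_diff_inverse nat_add_left_cancel_less not_less)
    moreover have "\<forall>i\<in>{..<K}. (cmod (z i + (\<Sum>l<m. X i (K + l) * z (K + l))))\<^sup>2 = 0"
      using top0 by (subst (asm) sum_nonneg_eq_0_iff) auto
    ultimately show False using no sing(3) by simp
  qed
  then obtain l where l: "l < m" "z (K + l) \<noteq> 0" by blast
  obtain Y where Y: "\<And>i j. i < m \<Longrightarrow> j < m \<Longrightarrow> gram (m - 1) Y i j = S i j"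
    using singular_psd_gram_factor[of m S "\<lambda>l. z (K + l)" l] hermS psdS singS l by blast
  \<comment> \<open>In block form \<open>Z\<close> is \<open>[I, 0; B, Y]\<close>, where
    \<open>B\<close> is the lower left block of \<open>X\<close>. Since \<open>Y Y^H = S\<close>,
    the lower right block of \<open>Z Z^H\<close> is \<open>B B^H + S\<close>, that of
    \<open>X\<close>. The factor \<open>Y\<close> has only \<open>m - 1\<close> columns, which saves
    one column overall.\<close>
  define Z where "Z i j = (if i < K then if i = j then 1 else 0
      else if j < K then X i j else Y (i - K) (j - K))" for i j
  have N1: "N - 1 = K + (m - 1)" using l N by simp
  have split: "gram (N - 1) Z i j = (\<Sum>p<K. Z i p * cnj (Z j p)) + (\<Sum>p<m - 1. Z i (K + p) * cnj (Z j (K + p)))" for i j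
    unfolding gram_def N1 by (rule sum_lessThan_add)
  have "gram (N - 1) Z i j = X i j" if ij: "i < N" "j < N" for i j
  proof -
    consider "i < K" | "j < K" "\<not> i < K" | "\<not> i < K" "\<not> j < K" by blast
    then show ?thesis
    proof cases
      case 1
      have "(\<Sum>p<K. Z i p * cnj (Z j p)) = (\<Sum>p<K. if p = i then cnj (Z j i) else 0)"
        using 1 by (intro sum.cong) (auto simp: Z_def)
      also have "\<dots> = X i j" using 1 ij by (simp add: Z_def block hermD)
      finally show ?thesis using 1 unfolding split by (simp add: Z_def)
    next
      case 2
      have "(\<Sum>p<K. Z i p * cnj (Z j p)) = (\<Sum>p<K. if p = j then Z i j else 0)"
        using 2 by (intro sum.cong) (auto simp: Z_def)
      also have "\<dots> = X i j" using 2 ij by (simp add: Z_def)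
      finally show ?thesis using 2 unfolding split by (simp add: Z_def)
    next
      case 3
      define p q where "p = i - K" and "q = j - K"
      have pq: "i = K + p" "j = K + q" "p < m" "q < m" using 3 ij N by (auto simp: p_def q_def)
      have "gram (N - 1) Z i j = (\<Sum>r<K. X i r * cnj (X j r)) + gram (m - 1) Y p q"
        unfolding split by (simp add: Z_def pq gram_def)
      also have "(\<Sum>r<K. X i r * cnj (X j r)) = (\<Sum>r<K. X i r * X r j)"
        using ij K by (intro sum.cong refl) (simp add: hermD)
      finally show ?thesis using Y[OF pq(3,4)] by (simp add: S_def pq)
    qed
  qed
  moreover have "K < N" using l N by simp
  ultimately show thesis using that[of Z] by (simp add: Z_def)
qed

text \<open>Let \<mu> < 0 be the minimum of the form on the unit sphere. For
  \<open>t = - 1 / \<mu>\<close> the form of \<open>I + t D\<close> is nonnegative and vanishes at a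
  minimiser.\<close>

lemma exists_singular_shift:
  assumes neg: "quad_form N D y < 0"
  obtains t z j where "t > 0" "\<And>w. 0 \<le> (\<Sum>j<N. (cmod (w j))\<^sup>2) + t * quad_form N D w"
    "(\<Sum>j<N. (cmod (z j))\<^sup>2) + t * quad_form N D z = 0" "j < N" "z j \<noteq> 0"
proof -
  \<comment> \<open>Coordinates from \<open>N\<close> on are fixed at 0, so that the unit sphere of
    the first \<open>N\<close> coordinates is compact.\<close>
  define box where "box = {f :: nat \<Rightarrow> complex. (\<forall>j\<in>{..<N}. cmod (f j) \<le> 1) \<and> (\<forall>j. j \<notin> {..<N} \<longrightarrow> f j = 0)}"
  define sphere where "sphere = box \<inter> {f. (\<Sum>j<N. (cmod (f j))\<^sup>2) = 1}"
  have cont: "continuous_on UNIV (\<lambda>f :: nat \<Rightarrow> complex. f p)" for p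
    by simp
  have "closed {f :: nat \<Rightarrow> complex. (\<Sum>j<N. (cmod (f j))\<^sup>2) = 1}"
    by (intro closed_Collect_eq continuous_intros cont)
  then have cpt: "compact sphere"
    unfolding sphere_def box_def by (intro compact_Int_closed compact_bounded_functions)
  have scale: "quad_form N D (\<lambda>j. of_real c * w j) = c\<^sup>2 * quad_form N D w" for c w
  proof -
    have "(\<Sum>i<N. \<Sum>j<N. cnj (of_real c * w i) * D i j * (of_real c * w j))
        = of_real (c\<^sup>2) * (\<Sum>i<N. \<Sum>j<N. cnj (w i) * D i j * w j)"
      unfolding sum_distrib_left by (intro sum.cong refl) (simp add: power2_eq_square)
    then show ?thesis by (simp add: quad_form_def del: of_real_power)
  qed
  \<comment> \<open>The form is homogeneous of degree 2, so its bounds on the sphere transfer to all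
    vectors with a nonzero coordinate below \<open>N\<close>.\<close>
  have normalise: "\<exists>f\<in>sphere. quad_form N D f = quad_form N D w / (\<Sum>j<N. (cmod (w j))\<^sup>2)"
    if pos: "0 < (\<Sum>j<N. (cmod (w j))\<^sup>2)" for w
  proof
    define s where "s = (\<Sum>j<N. (cmod (w j))\<^sup>2)"
    define f where "f j = (if j < N then of_real (1 / sqrt s) * w j else 0)" for j
    have s: "s > 0" using pos by (simp add: s_def)
    have cf: "(cmod (f j))\<^sup>2 = (cmod (w j))\<^sup>2 / s" if "j < N" for j
      using that s by (simp add: f_def norm_mult norm_divide power_mult_distrib power_divide)
    have "(\<Sum>j<N. (cmod (f j))\<^sup>2) = 1"
      using s by (simp add: cf s_def flip: sum_divide_distrib)
    moreover have "cmod (f j) \<le> 1" if "j < N" for j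
    proof -
      have "(cmod (f j))\<^sup>2 \<le> (\<Sum>j<N. (cmod (f j))\<^sup>2)"
        using that by (intro member_le_sum) auto
      then show ?thesis
        using \<open>(\<Sum>j<N. (cmod (f j))\<^sup>2) = 1\<close> by (simp add: abs_square_le_1)
    qed
    ultimately show "f \<in> sphere"
      by (simp add: sphere_def box_def f_def)
    have "quad_form N D f = quad_form N D (\<lambda>j. of_real (1 / sqrt s) * w j)"
      by (rule quad_form_cong) (auto simp: f_def)
    then show "quad_form N D f = quad_form N D w / (\<Sum>j<N. (cmod (w j))\<^sup>2)"
      using s unfolding scale by (simp add: power_divide flip: s_def)
  qed
  have zero: "quad_form N D w = 0" if "\<not> 0 < (\<Sum>j<N. (cmod (w j))\<^sup>2)" for w
  proof -
    have "(\<Sum>j<N. (cmod (w j))\<^sup>2) = 0"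
      using that sum_nonneg[of "{..<N}" "\<lambda>j. (cmod (w j))\<^sup>2"] by simp
    then have "\<forall>j\<in>{..<N}. w j = 0"
      by (subst (asm) sum_nonneg_eq_0_iff) auto
    then show ?thesis by (simp add: quad_form_def)
  qed
  have ypos: "0 < (\<Sum>j<N. (cmod (y j))\<^sup>2)" using zero[of y] neg by linarith
  then have "sphere \<noteq> {}" using normalise by blast
  moreover have "continuous_on sphere (quad_form N D)"
    unfolding quad_form_def[abs_def]
    by (intro continuous_intros continuous_on_subset[OF cont]) auto
  ultimately obtain z where z: "z \<in> sphere" "\<And>f. f \<in> sphere \<Longrightarrow> quad_form N D z \<le> quad_form N D f"
    using continuous_attains_inf[OF cpt] by blast
  define \<mu> where "\<mu> = quad_form N D z"
  have "\<mu> < 0"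
  proof -
    obtain f where "f \<in> sphere" "quad_form N D f = quad_form N D y / (\<Sum>j<N. (cmod (y j))\<^sup>2)"
      using normalise[OF ypos] by blast
    then show ?thesis
      using z(2)[of f] divide_neg_pos[OF neg ypos] by (simp add: \<mu>_def)
  qed
  have z1: "(\<Sum>j<N. (cmod (z j))\<^sup>2) = 1" using z(1) by (simp add: sphere_def)
  then obtain j where "j < N" "z j \<noteq> 0"
    by (metis (no_types, lifting) lessThan_iff norm_zero sum.neutral zero_neq_one zero_power2)
  moreover have "0 \<le> (\<Sum>j<N. (cmod (w j))\<^sup>2) + - 1 / \<mu> * quad_form N D w" for w
  proof (cases "0 < (\<Sum>j<N. (cmod (w j))\<^sup>2)")
    case True
    obtain f where f: "f \<in> sphere" "quad_form N D f = quad_form N D w / (\<Sum>j<N. (cmod (w j))\<^sup>2)"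
      using normalise[OF True] by blast
    have "\<mu> * (\<Sum>j<N. (cmod (w j))\<^sup>2) \<le> quad_form N D w"
      using z(2)[OF f(1)] True by (simp add: f(2) \<mu>_def field_simps)
    then show ?thesis using \<open>\<mu> < 0\<close> by (simp add: field_simps)
  next
    case False
    then show ?thesis using zero[OF False] by (simp add: sum_nonneg)
  qed
  moreover have "(\<Sum>j<N. (cmod (z j))\<^sup>2) + - 1 / \<mu> * quad_form N D z = 0"
    using \<open>\<mu> < 0\<close> by (simp add: z1 flip: \<mu>_def)
  moreover have "- 1 / \<mu> > 0" using \<open>\<mu> < 0\<close> by (simp add: divide_neg_neg)
  ultimately show thesis by (intro that[of "- 1 / \<mu>" z j])
qed

section \<open>Removing columns\<close>

text \<open>Gaussian elimination: a pivot \<open>p\<close> of the last equation removes one unknown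
  and one equation.\<close>

lemma underdetermined_system:
  fixes L :: "nat \<Rightarrow> 'i \<Rightarrow> 'a :: field"
  assumes "finite S" "d < card S"
  shows "\<exists>c. (\<exists>s\<in>S. c s \<noteq> 0) \<and> (\<forall>i<d. (\<Sum>s\<in>S. c s * L i s) = 0)"
  using assms
proof (induction d arbitrary: S L)
  case 0
  then obtain s where "s \<in> S" by fastforce
  then show ?case by (intro exI[of _ "\<lambda>_. 1"]) auto
next
  case (Suc d)
  show ?case
  proof (cases "\<forall>s\<in>S. L d s = 0")
    case True
    obtain c where "\<exists>s\<in>S. c s \<noteq> 0" "\<forall>i<d. (\<Sum>s\<in>S. c s * L i s) = 0"
      using Suc.IH[of S L] Suc.prems by auto
    moreover have "(\<Sum>s\<in>S. c s * L d s) = 0" using True by simp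
    ultimately show ?thesis by (auto simp: less_Suc_eq)
  next
    case False
    then obtain p where p: "p \<in> S" "L d p \<noteq> 0" by auto
    define T where "T = S - {p}"
    have T: "finite T" "d < card T" using Suc.prems p by (auto simp: T_def)
    obtain c where c: "\<exists>s\<in>T. c s \<noteq> 0"
      "\<forall>i<d. (\<Sum>s\<in>T. c s * (L i s - L d s / L d p * L i p)) = 0"
      using Suc.IH[OF T, of "\<lambda>i s. L i s - L d s / L d p * L i p"] by auto
    \<comment> \<open>The value of the eliminated unknown that satisfies the last equation.\<close>
    define q where "q = - (\<Sum>s\<in>T. c s * L d s) / L d p"
    define c' where "c' = c(p := q)"
    have sum: "(\<Sum>s\<in>S. c' s * L i s) = q * L i p + (\<Sum>s\<in>T. c s * L i s)" for i
    proof -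
      have "(\<Sum>s\<in>S. c' s * L i s) = c' p * L i p + (\<Sum>s\<in>T. c' s * L i s)"
        using Suc.prems p by (simp add: T_def sum.remove)
      also have "(\<Sum>s\<in>T. c' s * L i s) = (\<Sum>s\<in>T. c s * L i s)"
        by (intro sum.cong) (auto simp: T_def c'_def)
      finally show ?thesis by (simp add: c'_def)
    qed
    have "(\<Sum>s\<in>S. c' s * L i s) = 0" if "i < d" for i
    proof -
      have "0 = (\<Sum>s\<in>T. c s * L i s) - (\<Sum>s\<in>T. c s * L d s) / L d p * L i p"
        using c(2) that by (simp add: right_diff_distrib sum_subtractf sum_distrib_right
            sum_divide_distrib mult.assoc)
      then show ?thesis unfolding sum q_def by simp
    qed
    moreover have "(\<Sum>s\<in>S. c' s * L d s) = 0" unfolding sum q_def using p by simp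
    moreover have "\<exists>s\<in>S. c' s \<noteq> 0" using c(1) by (auto simp: c'_def T_def)
    ultimately show ?thesis by (auto simp: less_Suc_eq)
  qed
qed

section \<open>Real traces and a real basis of the Hermitian matrices\<close>

definition weighted_trace :: "nat \<Rightarrow> (nat \<Rightarrow> nat \<Rightarrow> complex) \<Rightarrow> (nat \<Rightarrow> nat \<Rightarrow> complex) \<Rightarrow> real" where
  "weighted_trace n Q R = Re (\<Sum>a<n. \<Sum>b<n. Q a b * R b a)"

text \<open>The product \<open>V X V^H\<close>, the covariance that results when \<open>X\<close> is
  inserted between the factors of \<open>V V^H\<close>.\<close>

definition sandwich :: "nat \<Rightarrow> (nat \<Rightarrow> nat \<Rightarrow> complex) \<Rightarrow> (nat \<Rightarrow> nat \<Rightarrow> complex) \<Rightarrow> nat \<Rightarrow> nat \<Rightarrow> complex" where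
  "sandwich N V X a b = (\<Sum>j<N. \<Sum>l<N. V a j * X j l * cnj (V b l))"

text \<open>The standard real basis of the Hermitian matrices, indexed by all pairs: pairs on or
  above the diagonal give the real symmetric units, pairs below it the imaginary antisymmetric ones.
  Hence the number of admissible pairs is the real dimension.\<close>

definition hermitian_unit :: "nat \<times> nat \<Rightarrow> nat \<Rightarrow> nat \<Rightarrow> complex" where
  "hermitian_unit s i j = (if fst s \<le> snd s then of_bool (s = (i, j) \<or> s = (j, i))
     else \<i> * (of_bool (s = (j, i)) - of_bool (s = (i, j))))"

lemma hermitian_unit_eq_0: "s \<noteq> (i, j) \<Longrightarrow> s \<noteq> (j, i) \<Longrightarrow> hermitian_unit s i j = 0"
  by (simp add: hermitian_unit_def)

lemma cnj_hermitian_unit: "cnj (hermitian_unit s i j) = hermitian_unit s j i"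
proof (cases "i = j")
  case False
  then show ?thesis
    by (cases "s = (i, j)"; cases "s = (j, i)") (simp_all add: hermitian_unit_def)
qed (simp add: hermitian_unit_def)

text \<open>In a real combination of units, the real part of an entry on or above the diagonal is
  the coefficient at its own position.\<close>

lemma Re_hermitian_unit:
  assumes "i \<le> j"
  shows "Re (hermitian_unit s i j) = (if s = (i, j) then 1 else 0)"
proof (cases "s = (i, j)")
  case False
  then show ?thesis
    using assms
    by (cases "s = (j, i)") (simp_all add: hermitian_unit_def)
qed (simp add: hermitian_unit_def assms)

text \<open>The imaginary part of an entry above the diagonal is the coefficient at the transposed
  position.\<close>

lemma Im_hermitian_unit:
  assumes "j < i"
  shows "Im (hermitian_unit s j i) = (if s = (i, j) then 1 else 0)"
proof (cases "s = (i, j)")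
  case False
  then show ?thesis
    using assms
    by (cases "s = (j, i)") (simp_all add: hermitian_unit_def)
qed (use assms in \<open>simp add: hermitian_unit_def\<close>)

text \<open>Hermitian matrices that vanish on the leading block form a real space of dimension
  \<open>N\<^sup>2 - K\<^sup>2\<close>, so \<open>d\<close> real linear functionals have a common
  nonzero zero on it when \<open>d\<close> is smaller.\<close>

lemma exists_hermitian_direction:
  fixes F :: "nat \<Rightarrow> (nat \<Rightarrow> nat \<Rightarrow> complex) \<Rightarrow> real"
  assumes dims: "K \<le> N" "K\<^sup>2 + d < N\<^sup>2"
    and linear: "\<And>i (S :: (nat \<times> nat) set) c E.
      F i (\<lambda>p q. \<Sum>s\<in>S. complex_of_real (c s) * E s p q) = (\<Sum>s\<in>S. c s * F i (E s))"
  obtains D p q where "hermitian_on N D" "\<And>i j. i < K \<Longrightarrow> j < K \<Longrightarrow> D i j = 0"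
    "\<And>i. i < d \<Longrightarrow> F i D = 0" "p < N" "q < N" "D p q \<noteq> 0"
proof -
  define S where "S = {..<N} \<times> {..<N} - {..<K} \<times> {..<K}"
  have S: "finite S" by (simp add: S_def)
  have "card S = N\<^sup>2 - K\<^sup>2"
    unfolding S_def using dims(1)
    by (subst card_Diff_subset) (auto simp: card_cartesian_product power2_eq_square)
  then have "d < card S" using dims(2) by simp
  obtain c s where c: "s \<in> S" "c s \<noteq> 0" "\<forall>i<d. (\<Sum>s\<in>S. c s * F i (hermitian_unit s)) = 0"
    using underdetermined_system[OF S \<open>d < card S\<close>, of "\<lambda>i s. F i (hermitian_unit s)"] by blast
  define D where "D = (\<lambda>i j. \<Sum>s\<in>S. complex_of_real (c s) * hermitian_unit s i j)"
  have herm: "hermitian_on N D"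
    by (simp add: hermitian_on_def D_def cnj_hermitian_unit)
  have block: "D i j = 0" if "i < K" "j < K" for i j
    unfolding D_def
  proof (intro sum.neutral ballI)
    fix s assume "s \<in> S"
    obtain p q where pq: "s = (p, q)" by fastforce
    then have "\<not> (p < K \<and> q < K)" using \<open>s \<in> S\<close> by (simp add: S_def)
    then have "(i, j) \<noteq> (p, q)" "(i, j) \<noteq> (q, p)" using that by auto
    then have "hermitian_unit s i j = 0" by (intro hermitian_unit_eq_0) (auto simp: pq)
    then show "complex_of_real (c s) * hermitian_unit s i j = 0" by simp
  qed
  have F0: "F i D = 0" if "i < d" for i
    using c(3) that by (simp add: D_def linear)
  obtain p q where s: "s = (p, q)" "p < N" "q < N"
    using c(1) by (auto simp: S_def)
  show thesis
  proof (cases "p \<le> q")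
    case True
    have "Re (D p q) = (\<Sum>s'\<in>S. if s' = s then c s' else 0)"
      unfolding D_def Re_sum by (intro sum.cong refl) (simp add: Re_hermitian_unit[OF True] s(1))
    also have "\<dots> = c s" using c(1) S by simp
    finally have "D p q \<noteq> 0" using c(2) by (metis zero_complex.sel(1))
    then show thesis using that[OF herm block F0 s(2,3)] by simp
  next
    case False
    have "Im (D q p) = (\<Sum>s'\<in>S. if s' = s then c s' else 0)"
      unfolding D_def Im_sum using False by (intro sum.cong refl) (simp add: Im_hermitian_unit s(1))
    also have "\<dots> = c s" using c(1) S by simp
    finally have "D q p \<noteq> 0" using c(2) by (metis zero_complex.sel(2))
    then show thesis using that[OF herm block F0 s(3,2)] by simp
  qed
qed

text \<open>Polarisation: if \<open>z^H D z\<close> vanished for all \<open>z\<close>, then so would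
  the real part of \<open>x^H D y\<close> for all \<open>x\<close> and \<open>y\<close>, hence every
  entry.\<close>

lemma hermitian_form_nonzero:
  assumes herm: "hermitian_on N D" and nz: "p < N" "q < N" "D p q \<noteq> 0"
  obtains z where "quad_form N D z \<noteq> 0"
proof (rule ccontr)
  assume "\<not> thesis"
  then have zero: "quad_form N D z = 0" for z using that by blast
  define b where "b x y = (\<Sum>i<N. \<Sum>j<N. cnj (x i) * D i j * y j)" for x y
  have sym: "b y x = cnj (b x y)" for x y
    unfolding b_def cnj_sum
    by (subst sum.swap, intro sum.cong refl) (simp add: hermitian_onD[OF herm])
  have "b (\<lambda>i. x i + y i) (\<lambda>i. x i + y i) = b x x + b x y + b y x + b y y" for x y
    unfolding b_def sum.distrib[symmetric] by (intro sum.cong refl) (simp add: algebra_simps)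
  moreover have "Re (b x x) = 0" for x
    using zero[of x] by (simp add: quad_form_def b_def)
  ultimately have Re_sum_0: "Re (b x y) + Re (b y x) = 0" for x y
    by (metis add_0 add.right_neutral plus_complex.sel(1))
  have real0: "Re (b x y) = 0" for x y
  proof -
    have "Re (b y x) = Re (b x y)" unfolding sym[of x y] by simp
    then show ?thesis using Re_sum_0[of x y] by linarith
  qed
  \<comment> \<open>The factor \<open>cnj (D p q)\<close> makes \<open>x^H D y\<close> equal to
    \<open>|D p q|^2\<close>, since only real parts are known to vanish.\<close>
  define x y where "x = (\<lambda>i. if i = p then 1 else 0 :: complex)"
    and "y = (\<lambda>i. if i = q then cnj (D p q) else 0)"
  have "b x y = (\<Sum>i<N. if i = p then (\<Sum>j<N. if j = q then D p q * cnj (D p q) else 0) else 0)"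
    unfolding b_def x_def y_def
    by (intro sum.cong refl) (auto intro!: sum.cong simp del: sum.delta sum.delta')
  also have "\<dots> = D p q * cnj (D p q)" using nz(1,2) by simp
  finally have "Re (D p q * cnj (D p q)) = 0" using real0[of x y] by simp
  then have "(cmod (D p q))\<^sup>2 = 0"
    by (simp only: mult.commute[of "D p q"] Re_cnj_mult_self)
  then show False using nz(3) by simp
qed

section \<open>Inserting a matrix between the factors of the covariance\<close>

lemma weighted_trace_sum:
  "weighted_trace n Q (\<lambda>a b. \<Sum>s\<in>S. complex_of_real (c s) * R s a b)
    = (\<Sum>s\<in>S. c s * weighted_trace n Q (R s))"
proof -
  have "(\<Sum>a<n. \<Sum>b<n. Q a b * (\<Sum>s\<in>S. of_real (c s) * R s b a))
      = (\<Sum>s\<in>S. of_real (c s) * (\<Sum>a<n. \<Sum>b<n. Q a b * R s b a))"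
    unfolding sum_distrib_left sum.swap[of _ S] by (simp add: mult_ac)
  then show ?thesis by (simp add: weighted_trace_def)
qed

lemma sandwich_sum:
  "sandwich N V (\<lambda>j l. \<Sum>s\<in>S. c s * E s j l) a b = (\<Sum>s\<in>S. c s * sandwich N V (E s) a b)"
  unfolding sandwich_def sum_distrib_left sum_distrib_right sum.swap[of _ S] by (simp add: mult_ac)

lemma sandwich_identity_add:
  "sandwich N V (\<lambda>j l. (if j = l then 1 else 0) + c * D j l) a b = gram N V a b + c * sandwich N V D a b"
proof -
  have "(\<Sum>j<N. \<Sum>l<N. V a j * (if j = l then 1 else 0) * cnj (V b l)) = gram N V a b"
    unfolding gram_def
  proof (intro sum.cong refl)
    fix j assume j: "j \<in> {..<N}"
    have "(\<Sum>l<N. V a j * (if j = l then 1 else 0) * cnj (V b l))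
        = (\<Sum>l<N. if l = j then V a j * cnj (V b j) else 0)"
      by (intro sum.cong) auto
    then show "(\<Sum>l<N. V a j * (if j = l then 1 else 0) * cnj (V b l)) = V a j * cnj (V b j)"
      using j by simp
  qed
  then show ?thesis
    by (simp add: sandwich_def distrib_left distrib_right sum.distrib sum_distrib_left mult_ac)
qed

text \<open>The identity \<open>(V Z) (V Z)^H = V (Z Z^H) V^H\<close>: a factor \<open>Z\<close> of
  \<open>X\<close> with fewer columns realises the perturbed covariance with fewer beams.\<close>

lemma gram_mult:
  assumes "\<And>j l. j < N \<Longrightarrow> l < N \<Longrightarrow> gram M Z j l = X j l"
  shows "gram M (\<lambda>a j. \<Sum>l<N. V a l * Z l j) a b = sandwich N V X a b"
proof -
  have "gram M (\<lambda>a j. \<Sum>l<N. V a l * Z l j) a b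
      = (\<Sum>i<M. \<Sum>j<N. \<Sum>l<N. V a j * (Z j i * cnj (Z l i)) * cnj (V b l))"
    unfolding gram_def by (simp add: sum_product mult_ac)
  also have "\<dots> = (\<Sum>j<N. \<Sum>l<N. \<Sum>i<M. V a j * (Z j i * cnj (Z l i)) * cnj (V b l))"
    by (rule trans[OF sum.swap]) (intro sum.cong refl sum.swap)
  also have "\<dots> = (\<Sum>j<N. \<Sum>l<N. V a j * gram M Z j l * cnj (V b l))"
    unfolding gram_def by (simp only: sum_distrib_left sum_distrib_right)
  also have "\<dots> = sandwich N V X a b"
    unfolding sandwich_def using assms by (intro sum.cong refl) simp
  finally show ?thesis .
qed

lemma Re_sandwich_diag: "Re (sandwich N V D a a) = quad_form N D (\<lambda>j. cnj (V a j))"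
  by (simp add: sandwich_def quad_form_def)

lemma quad_form_identity_add:
  "quad_form N (\<lambda>j l. (if j = l then 1 else 0) + complex_of_real c * D j l) w
    = (\<Sum>j<N. (cmod (w j))\<^sup>2) + c * quad_form N D w"
proof -
  \<comment> \<open>The form at \<open>w\<close> is a diagonal entry of \<open>V X V^H\<close> when
    every row of \<open>V\<close> is the conjugate of \<open>w\<close>.\<close>
  have "quad_form N (\<lambda>j l. (if j = l then 1 else 0) + complex_of_real c * D j l) w
      = Re (sandwich N (\<lambda>_ j. cnj (w j)) (\<lambda>j l. (if j = l then 1 else 0) + of_real c * D j l) 0 0)"
    unfolding Re_sandwich_diag by simp
  also have "\<dots> = Re (gram N (\<lambda>_ j. cnj (w j)) 0 0) + c * Re (sandwich N (\<lambda>_ j. cnj (w j)) D 0 0)"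
    unfolding sandwich_identity_add by simp
  also have "Re (gram N (\<lambda>_ j. cnj (w j)) 0 0) = (\<Sum>j<N. (cmod (w j))\<^sup>2)"
    unfolding gram_def by (simp only: complex_cnj_cnj Re_sum Re_cnj_mult_self)
  finally show ?thesis unfolding Re_sandwich_diag by simp
qed

text \<open>Perturb the identity between the factors of \<open>V V\<^sup>H\<close> along a Hermitian direction that is
  invisible to the traces and to the first \<open>K\<close> columns, until it becomes singular. The sign of
  the direction is chosen so that the power does not grow.\<close>

lemma column_reduction_step:
  assumes dims: "K \<le> N" "K\<^sup>2 + d < N\<^sup>2"
  obtains W Y where "K < N"
    "\<And>i. i < d \<Longrightarrow> weighted_trace n (Q i) (gram (N - 1) W) = weighted_trace n (Q i) (gram N V)"
    "(\<Sum>a<n. Re (gram (N - 1) W a a)) \<le> (\<Sum>a<n. Re (gram N V a a))"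
    "\<And>a j. W a j = (if j < K then V a j else 0) + (\<Sum>l\<in>{K..<N}. V a l * Y l j)"
proof -
  obtain D p q where D: "hermitian_on N D" "\<And>i j. i < K \<Longrightarrow> j < K \<Longrightarrow> D i j = 0"
      "\<And>i. i < d \<Longrightarrow> weighted_trace n (Q i) (sandwich N V D) = 0"
    and pq: "p < N" "q < N" "D p q \<noteq> 0"
    by (rule exists_hermitian_direction[OF dims, of "\<lambda>i D. weighted_trace n (Q i) (sandwich N V D)"])
      (unfold sandwich_sum weighted_trace_sum, blast+)
  \<comment> \<open>The rate at which the power changes along \<open>D\<close>, namely the trace of
    \<open>V D V^H\<close>.\<close>
  define P where "P = (\<Sum>a<n. quad_form N D (\<lambda>j. cnj (V a j)))"
  have "\<exists>s y. s * P \<le> 0 \<and> s * quad_form N D y < (0 :: real)"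
  proof (cases "P = 0")
    case True
    obtain y where "quad_form N D y \<noteq> 0"
      using hermitian_form_nonzero[OF D(1) pq] by blast
    then show ?thesis
      using True by (intro exI[of _ "- quad_form N D y"] exI[of _ y]) (auto simp: zero_less_mult_iff)
  next
    case False
    \<comment> \<open>Since \<open>P\<close> is the sum of the forms at the conjugated rows, one of
      them has the sign of \<open>P\<close>. The choice \<open>s = - P\<close> then makes the form
      negative there while the power falls.\<close>
    have "\<exists>a<n. 0 < P * quad_form N D (\<lambda>j. cnj (V a j))"
    proof (rule ccontr)
      assume "\<not> ?thesis"
      then have "(\<Sum>a<n. P * quad_form N D (\<lambda>j. cnj (V a j))) \<le> 0"
        by (intro sum_nonpos) (metis lessThan_iff not_less)
      then have "P * P \<le> 0" by (simp add: P_def sum_distrib_left)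
      then show False using False by (auto simp: mult_le_0_iff)
    qed
    then obtain a where "0 < P * quad_form N D (\<lambda>j. cnj (V a j))" by blast
    then show ?thesis
      by (intro exI[of _ "- P"] exI[of _ "\<lambda>j. cnj (V a j)"]) simp
  qed
  then obtain s y where s: "s * P \<le> 0" "s * quad_form N D y < 0" by blast
  have scale: "quad_form N (\<lambda>i j. of_real s * D i j) w = s * quad_form N D w" for w
    by (simp add: quad_form_def sum_distrib_left mult_ac)
  obtain t z k where t: "t > 0" "\<And>w. 0 \<le> (\<Sum>j<N. (cmod (w j))\<^sup>2) + t * (s * quad_form N D w)"
      and z: "(\<Sum>j<N. (cmod (z j))\<^sup>2) + t * (s * quad_form N D z) = 0" "k < N" "z k \<noteq> 0"
    by (rule exists_singular_shift[of N "\<lambda>i j. of_real s * D i j" y])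
      (use s in \<open>simp_all add: scale\<close>)
  define X where "X = (\<lambda>j l. (if j = l then 1 else 0) + complex_of_real (t * s) * D j l)"
  have formX: "quad_form N X w = (\<Sum>j<N. (cmod (w j))\<^sup>2) + t * (s * quad_form N D w)" for w
    unfolding X_def quad_form_identity_add by (simp add: mult.assoc)
  have hermX: "hermitian_on N X"
    using hermitian_onD[OF D(1)] by (simp add: hermitian_on_def X_def)
  have psdX: "0 \<le> quad_form N X w" for w
    unfolding formX by (rule t(2))
  have singX: "quad_form N X z = 0"
    unfolding formX by (rule z(1))
  have blockX: "X i j = (if i = j then 1 else 0)" if "i < K" "j < K" for i j
    using that by (simp add: X_def D(2))
  obtain Z where Z: "\<And>i j. i < N \<Longrightarrow> j < N \<Longrightarrow> gram (N - 1) Z i j = X i j"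
    "\<And>i j. i < K \<Longrightarrow> Z i j = (if i = j then 1 else 0)" "K < N"
    using singular_psd_gram_factor_identity_block[OF hermX psdX singX z(2,3) dims(1) blockX] by blast
  define W where "W a j = (\<Sum>l<N. V a l * Z l j)" for a j
  have gramW: "gram (N - 1) W a b = gram N V a b + of_real (t * s) * sandwich N V D a b" for a b
  proof -
    have "gram (N - 1) W a b = sandwich N V X a b"
      unfolding W_def[abs_def] by (rule gram_mult) (rule Z(1))
    then show ?thesis unfolding X_def sandwich_identity_add .
  qed
  have "weighted_trace n (Q i) (gram (N - 1) W) = weighted_trace n (Q i) (gram N V)" if "i < d" for i
  proof -
    have "weighted_trace n (Q i) (gram (N - 1) W)
        = weighted_trace n (Q i) (gram N V) + t * s * weighted_trace n (Q i) (sandwich N V D)"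
      unfolding weighted_trace_def gramW
      by (simp add: distrib_left sum.distrib sum_distrib_left mult_ac)
    then show ?thesis using D(3)[OF that] by simp
  qed
  moreover have "(\<Sum>a<n. Re (gram (N - 1) W a a)) \<le> (\<Sum>a<n. Re (gram N V a a))"
  proof -
    have "(\<Sum>a<n. Re (gram (N - 1) W a a)) = (\<Sum>a<n. Re (gram N V a a)) + t * (s * P)"
      unfolding gramW P_def Re_sandwich_diag[symmetric]
      by (simp add: sum.distrib sum_distrib_left mult_ac)
    then show ?thesis using t(1) s(1) by (simp add: mult_le_0_iff)
  qed
  \<comment> \<open>The first \<open>K\<close> rows of \<open>Z\<close> are those of the identity,
    so each leading column survives and only columns from \<open>K\<close> on are added to
    it.\<close>
  moreover have "W a j = (if j < K then V a j else 0) + (\<Sum>l\<in>{K..<N}. V a l * Z l j)" for a j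
  proof -
    have "{..<N} = {..<K} \<union> {K..<N}" using dims(1) by auto
    then have "W a j = (\<Sum>l<K. V a l * Z l j) + (\<Sum>l\<in>{K..<N}. V a l * Z l j)"
      unfolding W_def by (simp add: sum.union_disjoint ivl_disj_int)
    moreover have "(\<Sum>l<K. V a l * Z l j) = (\<Sum>l<K. if l = j then V a j else 0)"
      by (intro sum.cong) (auto simp: Z(2))
    ultimately show ?thesis by simp
  qed
  ultimately show thesis using that[of W Z] Z(3) by blast
qed

text \<open>The single step is repeated while \<open>N\<^sup>2 > K\<^sup>2 + d\<close>. A channel at
  which all columns from \<open>K\<close> on are nulled keeps this property, because the step only
  adds combinations of those columns.\<close>

lemma column_reduction:
  assumes "K \<le> N"
  obtains M W where "K \<le> M" "M\<^sup>2 \<le> K\<^sup>2 + d"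
    "\<And>i. i < d \<Longrightarrow> weighted_trace n (Q i) (gram M W) = weighted_trace n (Q i) (gram N V)"
    "(\<Sum>a<n. Re (gram M W a a)) \<le> (\<Sum>a<n. Re (gram N V a a))"
    "\<And>h j. \<forall>l\<in>{K..<N}. response n h V l = 0 \<Longrightarrow> j < M \<Longrightarrow>
      response n h W j = (if j < K then response n h V j else 0)"
  using assms
proof (induction N arbitrary: V thesis rule: less_induct)
  case (less N)
  show ?case
  proof (cases "N\<^sup>2 \<le> K\<^sup>2 + d")
    case True
    then show ?thesis using less.prems(2) by (intro less.prems(1)[of N V]) auto
  next
    case False
    then have "K\<^sup>2 + d < N\<^sup>2" by simp
    then obtain W Y where "K < N" and W:
      "\<And>i. i < d \<Longrightarrow> weighted_trace n (Q i) (gram (N - 1) W) = weighted_trace n (Q i) (gram N V)"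
      "(\<Sum>a<n. Re (gram (N - 1) W a a)) \<le> (\<Sum>a<n. Re (gram N V a a))"
      "\<And>a j. W a j = (if j < K then V a j else 0) + (\<Sum>l\<in>{K..<N}. V a l * Y l j)"
      using column_reduction_step[OF less.prems(2), of d n Q V] by blast
    have resp: "response n h W j = (if j < K then response n h V j else 0)"
      if "\<forall>l\<in>{K..<N}. response n h V l = 0" for h j
    proof -
      have "response n h W j = (if j < K then response n h V j else 0)
          + (\<Sum>a<n. \<Sum>l\<in>{K..<N}. V a l * Y l j * cnj (h a))"
        unfolding response_def W(3)
        by (simp add: distrib_right sum.distrib sum_distrib_right)
      also have "(\<Sum>a<n. \<Sum>l\<in>{K..<N}. V a l * Y l j * cnj (h a))
          = (\<Sum>l\<in>{K..<N}. \<Sum>a<n. V a l * Y l j * cnj (h a))"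
        by (rule sum.swap)
      also have "\<dots> = (\<Sum>l\<in>{K..<N}. Y l j * response n h V l)"
        unfolding response_def sum_distrib_left by (simp add: mult_ac)
      finally show ?thesis using that by simp
    qed
    show ?thesis
    proof (rule less.IH[of "N - 1" W])
      show "N - 1 < N" "K \<le> N - 1" using \<open>K < N\<close> by auto
    next
      fix M U
      assume "K \<le> M" "M\<^sup>2 \<le> K\<^sup>2 + d" and U:
        "\<And>i. i < d \<Longrightarrow> weighted_trace n (Q i) (gram M U) = weighted_trace n (Q i) (gram (N - 1) W)"
        "(\<Sum>a<n. Re (gram M U a a)) \<le> (\<Sum>a<n. Re (gram (N - 1) W a a))"
        "\<And>h j. \<forall>l\<in>{K..<N - 1}. response n h W l = 0 \<Longrightarrow> j < M \<Longrightarrow>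
          response n h U j = (if j < K then response n h W j else 0)"
      then show ?thesis
      proof (intro less.prems(1)[of M U])
        show "weighted_trace n (Q i) (gram M U) = weighted_trace n (Q i) (gram N V)" if "i < d" for i
          using U(1)[OF that] W(1)[OF that] by simp
        show "(\<Sum>a<n. Re (gram M U a a)) \<le> (\<Sum>a<n. Re (gram N V a a))"
          using U(2) W(2) by simp
        fix h j assume h: "\<forall>l\<in>{K..<N}. response n h V l = 0" and "j < M"
        \<comment> \<open>The remaining columns are still nulled at \<open>h\<close>, so the
          induction hypothesis applies to the same channel.\<close>
        have "\<forall>l\<in>{K..<N - 1}. response n h W l = 0" using resp[OF h] by simp
        then show "response n h U j = (if j < K then response n h V j else 0)"
          using U(3)[OF _ \<open>j < M\<close>] resp[OF h] by simp
      qed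
    qed
  qed
qed

section \<open>Reduction of the number of beams\<close>

abbreviation entries :: "complex mat \<Rightarrow> nat \<Rightarrow> nat \<Rightarrow> complex" where
  "entries V a j \<equiv> V $$ (a, j)"

lemma mat_adjoint_carrier: "V \<in> carrier_mat n N \<Longrightarrow> mat_adjoint V \<in> carrier_mat N n"
  by (auto simp: mat_adjoint_def)

lemma mat_adjoint_index:
  "V \<in> carrier_mat n N \<Longrightarrow> i < N \<Longrightarrow> j < n \<Longrightarrow> mat_adjoint V $$ (i, j) = cnj (V $$ (j, i))"
  by (auto simp: mat_adjoint_def mat_of_rows_def)

lemma mult_index_sum:
  assumes "A \<in> carrier_mat n m" "B \<in> carrier_mat m l" "i < n" "j < l"
  shows "(A * B) $$ (i, j) = (\<Sum>k<m. A $$ (i, k) * B $$ (k, j))"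
  using assms by (auto simp: scalar_prod_def atLeast0LessThan)

lemma mult_adjoint_index:
  assumes "A \<in> carrier_mat m N" "V \<in> carrier_mat n N" "i < m" "j < n"
  shows "(A * mat_adjoint V) $$ (i, j) = (\<Sum>k<N. A $$ (i, k) * cnj (V $$ (j, k)))"
  using assms
  by (simp add: mult_index_sum[OF assms(1) mat_adjoint_carrier[OF assms(2)]] mat_adjoint_index)

lemma quad_trace_eq_weighted_trace:
  assumes Q: "Q \<in> carrier_mat n n" and V: "V \<in> carrier_mat n N"
  shows "quad_trace Q V = weighted_trace n (entries Q) (gram N (entries V))"
proof -
  have QV: "Q * V \<in> carrier_mat n N" using Q V by simp
  have "(Q * V * mat_adjoint V) $$ (a, a) = (\<Sum>b<n. Q $$ (a, b) * gram N (entries V) b a)"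
    if "a < n" for a
  proof -
    have "(Q * V * mat_adjoint V) $$ (a, a)
        = (\<Sum>k<N. \<Sum>b<n. Q $$ (a, b) * (V $$ (b, k) * cnj (V $$ (a, k))))"
      using that by (simp add: mult_adjoint_index[OF QV V] mult_index_sum[OF Q V]
          sum_distrib_right mult.assoc del: index_mult_mat)
    also have "\<dots> = (\<Sum>b<n. \<Sum>k<N. Q $$ (a, b) * (V $$ (b, k) * cnj (V $$ (a, k))))"
      by (rule sum.swap)
    finally show ?thesis by (simp add: gram_def sum_distrib_left)
  qed
  moreover have "dim_row (Q * V * mat_adjoint V) = n" using Q by simp
  ultimately show ?thesis
    by (simp add: quad_trace_def mat_trace_def weighted_trace_def del: index_mult_mat)
qed

lemma tx_power_eq_gram:
  assumes V: "V \<in> carrier_mat n N"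
  shows "tx_power V = (\<Sum>a<n. Re (gram N (entries V) a a))"
  using V mult_adjoint_index[OF V V]
  by (simp add: tx_power_def mat_trace_def gram_def)

lemma beam_gain_eq_response:
  assumes V: "V \<in> carrier_mat n N" and h: "h \<in> carrier_vec n" and j: "j < N"
  shows "beam_gain h (comm_beam V j) = (cmod (response n (vec_index h) (entries V) j))\<^sup>2"
  using assms
  by (simp add: beam_gain_def comm_beam_def response_def scalar_prod_def atLeast0LessThan)

lemma sensing_interference_eq_response:
  assumes V: "V \<in> carrier_mat n N" and h: "h \<in> carrier_vec n" and K: "K \<le> N"
  shows "sensing_interference K h V
    = (\<Sum>j\<in>{K..<N}. (cmod (response n (vec_index h) (entries V) j))\<^sup>2)"
proof -
  define S where "S = sensing_beams K V"
  have S: "S \<in> carrier_mat n (N - K)" using V by (simp add: S_def sensing_beams_def)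
  have S_index: "S $$ (a, l) = V $$ (a, K + l)" if "a < n" "l < N - K" for a l
    using V that by (simp add: S_def sensing_beams_def)
  define T where "T = S * mat_adjoint S"
  have T: "T \<in> carrier_mat n n"
    unfolding T_def by (rule mult_carrier_mat[OF S mat_adjoint_carrier[OF S]])
  have T_index: "T $$ (a, b) = (\<Sum>l<N - K. S $$ (a, l) * cnj (S $$ (b, l)))" if "a < n" "b < n" for a b
    unfolding T_def using that by (rule mult_adjoint_index[OF S S])
  define r where "r l = (\<Sum>a<n. S $$ (a, l) * cnj (h $ a))" for l
  have r: "r l = response n (vec_index h) (entries V) (K + l)" if "l < N - K" for l
    using that by (simp add: r_def response_def S_index)
  have "(T *\<^sub>v h) \<bullet>c h = (\<Sum>a<n. (\<Sum>b<n. T $$ (a, b) * h $ b) * cnj (h $ a))"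
    using T h by (simp add: scalar_prod_def atLeast0LessThan)
  also have "\<dots> = (\<Sum>a<n. \<Sum>b<n. \<Sum>l<N - K. (S $$ (a, l) * cnj (h $ a)) * cnj (S $$ (b, l) * cnj (h $ b)))"
    by (simp add: T_index sum_distrib_right sum_distrib_left mult_ac)
  also have "\<dots> = (\<Sum>l<N - K. \<Sum>a<n. \<Sum>b<n. (S $$ (a, l) * cnj (h $ a)) * cnj (S $$ (b, l) * cnj (h $ b)))"
    by (rule sym, rule trans[OF sum.swap]) (intro sum.cong refl sum.swap)
  also have "\<dots> = (\<Sum>l<N - K. cnj (r l) * r l)"
    by (simp add: r_def sum_product cnj_sum mult.commute del: complex_cnj_mult)
  finally have "sensing_interference K h V = (\<Sum>l<N - K. (cmod (r l))\<^sup>2)"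
    unfolding sensing_interference_def S_def[symmetric] T_def[symmetric] by (simp only: Re_sum Re_cnj_mult_self)
  also have "\<dots> = (\<Sum>l<N - K. (cmod (response n (vec_index h) (entries V) (K + l)))\<^sup>2)"
    by (intro sum.cong refl) (simp add: r)
  also have "\<dots> = (\<Sum>j\<in>{K..<N}. (cmod (response n (vec_index h) (entries V) j))\<^sup>2)"
    using K by (intro sum.reindex_bij_witness[of _ "\<lambda>j. j - K" "\<lambda>l. K + l"]) auto
  finally show ?thesis .
qed

text \<open>The total received power is \<open>h^H V V^H h\<close>, so it depends on the beamformers
  only through their covariance.\<close>

lemma response_power_eq_quad_form:
  "(\<Sum>j<N. (cmod (response n h V j))\<^sup>2) = quad_form n (gram N V) h"
proof -
  have "(\<Sum>j<N. cnj (response n h V j) * response n h V j)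
      = (\<Sum>j<N. \<Sum>b<n. \<Sum>a<n. cnj (h a) * (V a j * cnj (V b j)) * h b)"
    unfolding response_def cnj_sum sum_product by (simp add: mult_ac)
  also have "\<dots> = (\<Sum>b<n. \<Sum>a<n. \<Sum>j<N. cnj (h a) * (V a j * cnj (V b j)) * h b)"
    by (rule trans[OF sum.swap]) (intro sum.cong refl sum.swap)
  also have "\<dots> = (\<Sum>a<n. \<Sum>b<n. cnj (h a) * gram N V a b * h b)"
    unfolding gram_def sum_distrib_left sum_distrib_right by (rule sum.swap)
  finally show ?thesis
    unfolding quad_form_def by (simp only: Re_sum[symmetric] Re_cnj_mult_self[symmetric])
qed

text \<open>Without cancellation all columns other than \<open>k\<close> interfere, so the
  denominator is the total received power minus the useful gain, plus noise. For a fixed covariance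
  only the useful gain can vary.\<close>

lemma SINR_NIC_eq_response:
  assumes V: "V \<in> carrier_mat n N" and H: "H k \<in> carrier_vec n" and k: "k < K" "K \<le> N"
  defines "p \<equiv> \<lambda>j. (cmod (response n (vec_index (H k)) (entries V) j))\<^sup>2"
  shows "SINR_NIC K H \<sigma>2 V k = p k / ((\<Sum>j<N. p j) - p k + \<sigma>2)"
proof -
  have gain: "beam_gain (H k) (comm_beam V i) = p i" if "i < K" for i
    unfolding p_def using that k by (intro beam_gain_eq_response[OF V H]) simp
  have "{..<N} = {..<K} \<union> {K..<N}" using k by auto
  then have "(\<Sum>j<N. p j) = (\<Sum>j<K. p j) + (\<Sum>j\<in>{K..<N}. p j)"
    by (simp add: sum.union_disjoint ivl_disj_int)
  also have "(\<Sum>j<K. p j) = p k + (\<Sum>j\<in>{..<K} - {k}. p j)"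
    using k by (simp add: sum.remove)
  finally show ?thesis
    using k sensing_interference_eq_response[OF V H k(2)]
    by (simp add: SINR_NIC_def gain p_def)
qed

section \<open>Fewer beams with the same sensing metric\<close>

lemma gram_add:
  "gram (K + M) V a b = gram K V a b + gram M (\<lambda>a l. V a (K + l)) a b"
  unfolding gram_def by (rule sum_lessThan_add)

lemma weighted_trace_cong:
  assumes "\<And>a b. a < n \<Longrightarrow> b < n \<Longrightarrow> R a b = R' a b"
  shows "weighted_trace n Q R = weighted_trace n Q R'"
  unfolding weighted_trace_def by (intro arg_cong[where f = Re] sum.cong refl) (simp add: assms)

lemma gram_mat:
  assumes "a < n" "b < n"
  shows "gram N (entries (mat n N (\<lambda>(i, j). U i j))) a b = gram N U a b"
  unfolding gram_def using assms by (intro sum.cong) auto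

text \<open>One family \<open>Q\<close> serves all numbers of columns, so equal traces give equal
  metrics even for beamformers of different sizes.\<close>

lemma d_quadratic_eqI:
  assumes "d_quadratic NT K d h"
  obtains Q where "\<And>V V' N N'. V \<in> carrier_mat NT N \<Longrightarrow> K \<le> N \<Longrightarrow> V' \<in> carrier_mat NT N' \<Longrightarrow> K \<le> N' \<Longrightarrow>
    (\<And>i. i < d \<Longrightarrow> weighted_trace NT (Q i) (gram N' (entries V')) = weighted_trace NT (Q i) (gram N (entries V)))
    \<Longrightarrow> h V' = h V"
proof -
  obtain Q f where Q: "\<forall>i<d. Q i \<in> carrier_mat NT NT \<and> hermitian_mat (Q i)"
    and f: "\<forall>V\<in>beamforming_mats NT K. h V = f (vec d (\<lambda>i. quad_trace (Q i) V))"
    using assms unfolding d_quadratic_def by blast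
  show thesis
  proof (rule that)
    fix V V' N N'
    assume V: "V \<in> carrier_mat NT N" "K \<le> N" "V' \<in> carrier_mat NT N'" "K \<le> N'"
      and eq: "\<And>i. i < d \<Longrightarrow> weighted_trace NT (entries (Q i)) (gram N' (entries V'))
        = weighted_trace NT (entries (Q i)) (gram N (entries V))"
    have "vec d (\<lambda>i. quad_trace (Q i) V') = vec d (\<lambda>i. quad_trace (Q i) V)"
    proof (intro eq_vecI)
      fix i assume "i < dim_vec (vec d (\<lambda>i. quad_trace (Q i) V))"
      then have i: "i < d" by simp
      then have "quad_trace (Q i) V' = quad_trace (Q i) V"
        using quad_trace_eq_weighted_trace[of "Q i" NT V' N']
          quad_trace_eq_weighted_trace[of "Q i" NT V N] V Q eq[OF i] by simp
      then show "vec d (\<lambda>i. quad_trace (Q i) V') $ i = vec d (\<lambda>i. quad_trace (Q i) V) $ i"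
        using i by simp
    qed simp
    moreover have "V \<in> beamforming_mats NT K" "V' \<in> beamforming_mats NT K"
      using V by (auto simp: beamforming_mats_def)
    ultimately show "h V' = h V" using f by simp
  qed
qed

text \<open>With cancellation the sensing beams enter only through their own covariance. They are
  reduced alone, with no protected column, to at most \<open>sqrt d\<close> beams; the communication
  beams and hence all SINRs stay the same.\<close>

lemma reduce_beams_IC:
  assumes d_quad: "d_quadratic NT K d h" and V: "V \<in> carrier_mat NT N" "K \<le> N"
  obtains M V' where "K \<le> M" "(M - K)\<^sup>2 \<le> d" "V' \<in> carrier_mat NT M"
    "tx_power V' \<le> tx_power V" "h V' = h V" "vSINR_IC K H \<sigma>2 V' = vSINR_IC K H \<sigma>2 V"
proof -
  obtain Q where Q: "\<And>V V' N N'. V \<in> carrier_mat NT N \<Longrightarrow> K \<le> N \<Longrightarrow> V' \<in> carrier_mat NT N' \<Longrightarrow> K \<le> N' \<Longrightarrow>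
    (\<And>i. i < d \<Longrightarrow> weighted_trace NT (Q i) (gram N' (entries V')) = weighted_trace NT (Q i) (gram N (entries V)))
    \<Longrightarrow> h V' = h V"
    using d_quadratic_eqI[OF d_quad] by blast
  define Vs where "Vs = (\<lambda>a l. V $$ (a, K + l))"
  obtain m U where m: "m\<^sup>2 \<le> 0\<^sup>2 + d"
    and U: "\<And>i. i < d \<Longrightarrow> weighted_trace NT (Q i) (gram m U) = weighted_trace NT (Q i) (gram (N - K) Vs)"
      "(\<Sum>a<NT. Re (gram m U a a)) \<le> (\<Sum>a<NT. Re (gram (N - K) Vs a a))"
    by (rule column_reduction[of 0 "N - K" d NT Q Vs]) auto
  define V' where "V' = mat NT (K + m) (\<lambda>(a, j). if j < K then V $$ (a, j) else U a (j - K))"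
  have V': "V' \<in> carrier_mat NT (K + m)" by (simp add: V'_def)
  have gram': "gram (K + m) (entries V') a b = gram K (entries V) a b + gram m U a b"
    if "a < NT" "b < NT" for a b
    unfolding V'_def gram_mat[OF that] gram_add by (simp add: gram_def)
  have gram: "gram N (entries V) a b = gram K (entries V) a b + gram (N - K) Vs a b" for a b
    using gram_add[of K "N - K" "entries V"] V(2) by (simp add: Vs_def)
  have wt_add: "weighted_trace NT R (\<lambda>a b. A a b + B a b) = weighted_trace NT R A + weighted_trace NT R B"
    for R A B
    by (simp add: weighted_trace_def distrib_left sum.distrib)
  have "h V' = h V"
  proof (rule Q[OF V V'])
    fix i assume "i < d"
    have "weighted_trace NT (Q i) (gram (K + m) (entries V'))
        = weighted_trace NT (Q i) (\<lambda>a b. gram K (entries V) a b + gram m U a b)"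
      by (rule weighted_trace_cong) (rule gram')
    also have "\<dots> = weighted_trace NT (Q i) (\<lambda>a b. gram N (entries V) a b)"
      unfolding gram wt_add using U(1)[OF \<open>i < d\<close>] by simp
    finally show "weighted_trace NT (Q i) (gram (K + m) (entries V'))
        = weighted_trace NT (Q i) (gram N (entries V))" .
  qed simp
  moreover have "tx_power V' \<le> tx_power V"
    using U(2) by (simp add: tx_power_eq_gram[OF V'] tx_power_eq_gram[OF V(1)] gram gram' sum.distrib)
  moreover have "comm_beam V' j = comm_beam V j" if "j < K" for j
    using that V by (intro eq_vecI) (auto simp: comm_beam_def V'_def)
  then have "vSINR_IC K H \<sigma>2 V' = vSINR_IC K H \<sigma>2 V"
    by (intro eq_vecI) (simp_all add: vSINR_IC_def SINR_IC_def)
  ultimately show thesis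
    using that[of "K + m" V'] V' m by simp
qed

text \<open>Nulling comes first and column reduction second: nulling keeps the covariance and cannot
  lower a useful gain, and the reduction then preserves the responses of all communication
  beams.\<close>

lemma reduce_beams_NIC:
  assumes d_quad: "d_quadratic NT K d h" and V: "V \<in> carrier_mat NT N" "K \<le> N"
    and H: "\<forall>k<K. H k \<in> carrier_vec NT" and \<sigma>2: "0 < \<sigma>2"
  obtains M V' where "K \<le> M" "M\<^sup>2 \<le> K\<^sup>2 + d" "V' \<in> carrier_mat NT M"
    "tx_power V' \<le> tx_power V" "h V' = h V" "vSINR_NIC K H \<sigma>2 V \<le> vSINR_NIC K H \<sigma>2 V'"
proof -
  obtain Q where Q: "\<And>V V' N N'. V \<in> carrier_mat NT N \<Longrightarrow> K \<le> N \<Longrightarrow> V' \<in> carrier_mat NT N' \<Longrightarrow> K \<le> N' \<Longrightarrow>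
    (\<And>i. i < d \<Longrightarrow> weighted_trace NT (Q i) (gram N' (entries V')) = weighted_trace NT (Q i) (gram N (entries V)))
    \<Longrightarrow> h V' = h V"
    using d_quadratic_eqI[OF d_quad] by blast
  define c where "c k = vec_index (H k)" for k
  obtain W where W: "\<And>a b. a < NT \<Longrightarrow> b < NT \<Longrightarrow> gram N W a b = gram N (entries V) a b"
    "\<And>k. k < K \<Longrightarrow> cmod (response NT (c k) (entries V) k) \<le> cmod (response NT (c k) W k)"
    "\<And>k j. k < K \<Longrightarrow> K \<le> j \<Longrightarrow> j < N \<Longrightarrow> response NT (c k) W j = 0"
    using exists_nulling_beamformers[OF V(2), of NT "entries V" c] by blast
  obtain M U where M: "K \<le> M" "M\<^sup>2 \<le> K\<^sup>2 + d"
    and U: "\<And>i. i < d \<Longrightarrow> weighted_trace NT (Q i) (gram M U) = weighted_trace NT (Q i) (gram N W)"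
      "(\<Sum>a<NT. Re (gram M U a a)) \<le> (\<Sum>a<NT. Re (gram N W a a))"
      "\<And>h j. \<forall>l\<in>{K..<N}. response NT h W l = 0 \<Longrightarrow> j < M \<Longrightarrow>
        response NT h U j = (if j < K then response NT h W j else 0)"
    using column_reduction[OF V(2), of d NT Q W] by blast
  define V' where "V' = mat NT M (\<lambda>(a, j). U a j)"
  have V': "V' \<in> carrier_mat NT M" by (simp add: V'_def)
  have gram': "gram M (entries V') a b = gram M U a b" if "a < NT" "b < NT" for a b
    unfolding V'_def by (rule gram_mat[OF that])
  have "h V' = h V"
  proof (rule Q[OF V V' M(1)])
    fix i assume "i < d"
    have "weighted_trace NT (Q i) (gram M (entries V')) = weighted_trace NT (Q i) (gram M U)"
      by (rule weighted_trace_cong) (rule gram')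
    also have "\<dots> = weighted_trace NT (Q i) (gram N W)" by (rule U(1)[OF \<open>i < d\<close>])
    also have "\<dots> = weighted_trace NT (Q i) (gram N (entries V))"
      by (rule weighted_trace_cong) (rule W(1))
    finally show "weighted_trace NT (Q i) (gram M (entries V')) = weighted_trace NT (Q i) (gram N (entries V))" .
  qed
  moreover have "tx_power V' \<le> tx_power V"
    using U(2) by (simp add: tx_power_eq_gram[OF V'] tx_power_eq_gram[OF V(1)] gram' W(1))
  moreover have "SINR_NIC K H \<sigma>2 V k \<le> SINR_NIC K H \<sigma>2 V' k" if k: "k < K" for k
  proof -
    have Hk: "H k \<in> carrier_vec NT" using H k by simp
    define p where "p j = (cmod (response NT (c k) (entries V) j))\<^sup>2" for j
    define q where "q j = (cmod (response NT (c k) W j))\<^sup>2" for j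
    have null: "\<forall>l\<in>{K..<N}. response NT (c k) W l = 0" using W(3)[OF k] by simp
    have resp': "response NT (c k) (entries V') j = (if j < K then response NT (c k) W j else 0)"
      if "j < M" for j
    proof -
      have "response NT (c k) (entries V') j = response NT (c k) U j"
        unfolding response_def V'_def using that by (intro sum.cong) auto
      then show ?thesis using U(3)[OF null that] by simp
    qed
    \<comment> \<open>\<open>W\<close> and \<open>V\<close> have the same covariance, so user
      \<open>k\<close> receives the same total power from both.\<close>
    have "(\<Sum>j<N. q j) = (\<Sum>j<N. p j)"
      unfolding p_def q_def response_power_eq_quad_form by (rule quad_form_cong) (simp_all add: W(1))
    moreover have "(\<Sum>j<M. (cmod (response NT (c k) (entries V') j))\<^sup>2) = (\<Sum>j<K. q j)"
      using M(1) by (intro sum.mono_neutral_cong_right) (auto simp: resp' q_def)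
    moreover have "(\<Sum>j<N. q j) = (\<Sum>j<K. q j)"
      using V(2) null by (intro sum.mono_neutral_cong_right) (auto simp: q_def)
    moreover have "SINR_NIC K H \<sigma>2 V' k
        = q k / ((\<Sum>j<M. (cmod (response NT (c k) (entries V') j))\<^sup>2) - q k + \<sigma>2)"
      using SINR_NIC_eq_response[where H = H and k = k, OF V' Hk k M(1), of \<sigma>2] resp'[of k] k M(1)
      by (simp add: c_def q_def)
    ultimately have 1: "SINR_NIC K H \<sigma>2 V' k = q k / ((\<Sum>j<N. p j) - q k + \<sigma>2)"
      and total: "(\<Sum>j<N. p j) = (\<Sum>j<K. q j)" by simp_all
    have 2: "SINR_NIC K H \<sigma>2 V k = p k / ((\<Sum>j<N. p j) - p k + \<sigma>2)"
      using SINR_NIC_eq_response[where H = H and k = k, OF V(1) Hk k V(2), of \<sigma>2] by (simp add: c_def p_def)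
    have pq: "p k \<le> q k" using W(2)[OF k] by (simp add: p_def q_def power_mono)
    \<comment> \<open>Together with \<open>\<sigma>2 > 0\<close> this keeps the smaller denominator
      positive, as the comparison of the fractions requires.\<close>
    have "q k \<le> (\<Sum>j<N. p j)"
      unfolding total using k by (intro member_le_sum) (auto simp: q_def)
    then show ?thesis
      unfolding 1 2 using pq \<sigma>2 by (intro frac_le) (auto simp: q_def)
  qed
  then have "vSINR_NIC K H \<sigma>2 V \<le> vSINR_NIC K H \<sigma>2 V'"
    by (simp add: less_eq_vec_def vSINR_NIC_def)
  ultimately show thesis
    using that[of M V'] V' M by simp
qed

theorem theorem3:
  fixes NT d K :: nat and \<sigma>2 P :: real
    and H :: "nat \<Rightarrow> complex Matrix.vec" and h\<^sub>d :: "complex mat \<Rightarrow> real"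
  assumes "NT \<ge> 1" and "d \<ge> 1" and "\<sigma>2 > 0" and "P > 0"
    and "\<forall>k<K. H k \<in> carrier_vec NT"
    and "d_quadratic NT K d h\<^sub>d"
  shows
    "(\<forall>(h, \<gamma>) \<in> achievable_set NT K P h\<^sub>d (vSINR_IC K H \<sigma>2).
        (\<forall>k<K. 0 < \<gamma> $ k) \<longrightarrow>
        (\<exists>N'. K \<le> N' \<and> int N' \<le> \<lfloor>real K + sqrt (real d)\<rfloor> \<and>
          (\<exists>V' \<in> carrier_mat NT N'.
             tx_power V' \<le> P \<and> h\<^sub>d V' = h \<and> \<gamma> \<le> vSINR_IC K H \<sigma>2 V')))
   \<and> (\<forall>(h, \<gamma>) \<in> achievable_set NT K P h\<^sub>d (vSINR_NIC K H \<sigma>2).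
        (\<forall>k<K. 0 < \<gamma> $ k) \<longrightarrow>
        (\<exists>N'. K \<le> N' \<and> int N' \<le> \<lfloor>sqrt ((real K)\<^sup>2 + real d)\<rfloor> \<and>
          (\<exists>V' \<in> carrier_mat NT N'.
             tx_power V' \<le> P \<and> h\<^sub>d V' = h \<and> \<gamma> \<le> vSINR_NIC K H \<sigma>2 V')))"
proof (intro conjI ballI; clarify)
  fix h \<gamma>
  assume "(h, \<gamma>) \<in> achievable_set NT K P h\<^sub>d (vSINR_IC K H \<sigma>2)"
  then obtain V where V: "V \<in> carrier_mat NT (NT + K)" "tx_power V \<le> P"
    and eq: "h = h\<^sub>d V" "\<gamma> = vSINR_IC K H \<sigma>2 V"
    by (auto simp: achievable_set_def)
  obtain M V' where M: "K \<le> M" "(M - K)\<^sup>2 \<le> d"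
    and V': "V' \<in> carrier_mat NT M" "tx_power V' \<le> tx_power V" "h\<^sub>d V' = h\<^sub>d V"
      "vSINR_IC K H \<sigma>2 V' = vSINR_IC K H \<sigma>2 V"
    using reduce_beams_IC[OF assms(6) V(1), of H \<sigma>2] by (metis le_add2)
  \<comment> \<open>The truncated difference is exact because \<open>K \<le> M\<close>, so the bound
    on the sensing beams carries over to \<open>M\<close>.\<close>
  have "real (M - K) \<le> sqrt (real d)"
    using M(2) by (intro real_le_rsqrt) (metis of_nat_le_iff of_nat_power)
  then have "int M \<le> \<lfloor>real K + sqrt (real d)\<rfloor>"
    unfolding le_floor_iff using M(1) by simp
  then show "\<exists>N'. K \<le> N' \<and> int N' \<le> \<lfloor>real K + sqrt (real d)\<rfloor> \<and>
      (\<exists>V' \<in> carrier_mat NT N'. tx_power V' \<le> P \<and> h\<^sub>d V' = h \<and> \<gamma> \<le> vSINR_IC K H \<sigma>2 V')"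
    using M(1) V' V(2) unfolding eq by (intro exI[of _ M] conjI bexI[of _ V']) simp_all
next
  fix h \<gamma>
  assume "(h, \<gamma>) \<in> achievable_set NT K P h\<^sub>d (vSINR_NIC K H \<sigma>2)"
  then obtain V where V: "V \<in> carrier_mat NT (NT + K)" "tx_power V \<le> P"
    and eq: "h = h\<^sub>d V" "\<gamma> = vSINR_NIC K H \<sigma>2 V"
    by (auto simp: achievable_set_def)
  obtain M V' where M: "K \<le> M" "M\<^sup>2 \<le> K\<^sup>2 + d"
    and V': "V' \<in> carrier_mat NT M" "tx_power V' \<le> tx_power V" "h\<^sub>d V' = h\<^sub>d V"
      "vSINR_NIC K H \<sigma>2 V \<le> vSINR_NIC K H \<sigma>2 V'"
    using reduce_beams_NIC[OF assms(6) V(1) _ assms(5,3)] by (metis le_add2)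
  have "real M \<le> sqrt ((real K)\<^sup>2 + real d)"
    using M(2) by (intro real_le_rsqrt) (metis of_nat_add of_nat_le_iff of_nat_power)
  then have "int M \<le> \<lfloor>sqrt ((real K)\<^sup>2 + real d)\<rfloor>"
    by (simp add: le_floor_iff)
  then show "\<exists>N'. K \<le> N' \<and> int N' \<le> \<lfloor>sqrt ((real K)\<^sup>2 + real d)\<rfloor> \<and>
      (\<exists>V' \<in> carrier_mat NT N'. tx_power V' \<le> P \<and> h\<^sub>d V' = h \<and> \<gamma> \<le> vSINR_NIC K H \<sigma>2 V')"
    using M(1) V' V(2) unfolding eq by (intro exI[of _ M] conjI bexI[of _ V']) simp_all
qed

end
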